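(* Let $\mathcal{T}$ be a Penrose (P2) tiling satisfying the matching rules, and let $\Delta_{\mathbf{n}}\colon\vec{E}\to\{-1,0,+1\}$ be the global bar-crossing function of the Ammann bar family with unit normal $\mathbf{n}$. Then: (i) (Cycle closure.) For every closed walk $v_0\to v_1\to\cdots\to v_k=v_0$ in $G_{\mathcal{T}}$, $\sum_{i=0}^{k-1}\Delta_{\mathbf{n}}(v_i\to v_{i+1})=0$. (ii) (Potential existence.) There exists $h_{\mathbf{n}}\colon V\to\mathbb{Z}$ such that $\Delta_{\mathbf{n}}(u\to v)=h_{\mathbf{n}}(v)-h_{\mathbf{n}}(u)$ for all $(u\to v)\in\vec{E}$, unique up to a global additive constant. (iii) (Identification.) The potential $h_{\mathbf{n}}$ coincides with the classical Ammann height function of $\mathcal{T}$ for the bar family with normal $\mathbf{n}$ (both taken with respect to a common reference vertex).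
   Context: Penrose P2 setting. The prototiles are the Penrose dart and kite: quadrilaterals with short edges of length $1$ and long edges of length $\varphi=(1+\sqrt5)/2$, tiling $\mathbb{R}^2$ edge-to-edge. Each prototile edge carries the standard Penrose (arrow/arc) decoration. The matching rule on an edge shared by two tiles is that the decorations which the two tiles place on this edge agree; the tiling satisfies the matching rules if this holds on every shared edge. Tiling adjacency graph: $G_{\mathcal{T}}=(V,E)$, $V$ the tiling vertices, $E$ the tile edges; $\vec{E}$ is the set of directed edges. $G_{\mathcal{T}}$ is connected and planar. Ammann bars. There are five bar families with unit normals $\mathbf{n}_k=(\cos(2\pi k/5),\sin(2\pi k/5))$, $k=0,\dots,4$; $\mathbf{n}$ is one of these. Each decorated prototile determines, from its own decoration alone, a finite collection of straight local bar segments inside the tile, lying on lines with normal $\mathbf{n}$ (the standard Ammann bar segments of P2). The bars of the family are the connected components of the union of all these segments over the tiles of $\mathcal{T}$. It is classical that the matching rules hold if and only if all bars are entire straight lines. Standing facts recorded in the paper about the standard P2 decorations and bars: (1) no bar is parallel to a tile edge and no bar passes through a tiling vertex; (2) for each tile and each family, each tile edge is crossed by at most one local bar segment of that family; (3) the five bar families correspond to the five edge-direction classes of P2: each edge-direction class determines a unique (relevant) family whose bars cross edges of that direction (its normal is parallel to the edge direction), and the other four families do not cross such edges; (4) every edge of a class is crossed by a local bar segment of its relevant family. Tile-side bar-crossing function: for a tile $t$ and a directed edge $(u\to v)$ on $\partial t$, $\Delta_{\mathbf{n}}^{(t)}(u\to v)=+1$ if a local bar segment of $t$ in the family crosses $(uv)$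 and $\mathbf{n}\cdot(v-u)>0$; $=-1$ if such a segment crosses and $\mathbf{n}\cdot(v-u)<0$; $=0$ otherwise. When the matching rules hold, these values agree for the tiles sharing an edge, and the global bar-crossing function is $\Delta_{\mathbf{n}}(u\to v)=\Delta_{\mathbf{n}}^{(t)}(u\to v)$ for any tile $t$ incident to $\{u,v\}$; it is antisymmetric. Classical Ammann height function: it assigns to each vertex $v$ the signed number of bars of the family between a reference vertex $v_0$ and $v$, i.e. the number crossed along any path from $v_0$ to $v$, with sign $+1$ for a crossing in the $\mathbf{n}$-direction and $-1$ for a crossing in the $-\mathbf{n}$-direction. It vanishes at $v_0$; $h_{\mathbf{n}}$ is compared with it under the normalisation $h_{\mathbf{n}}(v_0)=0$. *)

theory Defs
  imports "HOL-Analysis.Analysis"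
begin

text \<open>
  The plane is the complex plane, with its real inner product \<open>\<bullet>\<close>.
\<close>

definition phi :: real where
  "phi = (1 + sqrt 5) / 2"

section \<open>Prototiles and their placements\<close>

datatype shape = Kite | Dart

text \<open>
  \<open>Tile s a d\<close> is the copy of the prototile \<open>s\<close> whose corner between the two long edges
  is \<open>a\<close> and whose axis of symmetry points from \<open>a\<close> in the direction of the unit vector \<open>d\<close>.
  The decorated prototiles are mirror symmetric, so rotations and translations give every
  congruent copy. The five bar normals are taken parallel to the edge directions, which
  restricts the rotations to multiples of \<open>\<pi>/5\<close>.
\<close>

datatype tile = Tile (shape: shape) (apex: complex) (axis: complex)

definition valid_tile :: "tile \<Rightarrow> bool" where
  "valid_tile t \<longleftrightarrow> axis t ^ 10 = 1"

text \<open>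
  The corners in cyclic order are \<open>cA\<close>, \<open>cB\<close>, \<open>cC\<close>, \<open>cD\<close>. The long edges are
  \<open>cA cB\<close> and \<open>cA cD\<close>, the short ones \<open>cB cC\<close> and \<open>cC cD\<close>. The angle at \<open>cC\<close> is
  \<open>4\<pi>/5\<close> in the kite and the reflex angle \<open>6\<pi>/5\<close> in the dart.
\<close>

definition cA :: "tile \<Rightarrow> complex" where
  "cA t = apex t"

definition cB :: "tile \<Rightarrow> complex" where
  "cB t = apex t + of_real phi * axis t * cis (pi / 5)"

definition cC :: "tile \<Rightarrow> complex" where
  "cC t = apex t + (case shape t of Kite \<Rightarrow> of_real phi | Dart \<Rightarrow> 1) * axis t"

definition cD :: "tile \<Rightarrow> complex" where
  "cD t = apex t + of_real phi * axis t * cis (- (pi / 5))"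

definition corners :: "tile \<Rightarrow> complex set" where
  "corners t = {cA t, cB t, cC t, cD t}"

definition region :: "tile \<Rightarrow> complex set" where
  "region t = convex hull {cA t, cB t, cC t} \<union> convex hull {cA t, cC t, cD t}"

text \<open>
  The arrow decoration, each arrow being an ordered pair (tail, head). Together with the two
  edge lengths it forces the Penrose matching; in Conway's head/tail labelling of
  the corners, all arrows run from one label to the other.
\<close>

definition arrows :: "tile \<Rightarrow> (complex \<times> complex) set" where
  "arrows t = (case shape t of
      Kite \<Rightarrow> {(cA t, cB t), (cA t, cD t), (cC t, cB t), (cC t, cD t)}
    | Dart \<Rightarrow> {(cB t, cA t), (cD t, cA t), (cB t, cC t), (cD t, cC t)})"

definition edges :: "tile \<Rightarrow> complex set set" where
  "edges t = (\<lambda>(u, v). {u, v}) ` arrows t"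

section \<open>Tilings and matching rules\<close>

definition edge_to_edge :: "tile set \<Rightarrow> bool" where
  "edge_to_edge T \<longleftrightarrow>
    (\<forall>s\<in>T. \<forall>t\<in>T. \<forall>e\<in>edges s. \<forall>e'\<in>edges t.
       e \<noteq> e' \<longrightarrow> convex hull e \<inter> convex hull e' \<subseteq> corners s \<inter> corners t)"

definition P2_tiling :: "tile set \<Rightarrow> bool" where
  "P2_tiling T \<longleftrightarrow>
    (\<forall>t\<in>T. valid_tile t) \<and>
    (\<Union>t\<in>T. region t) = UNIV \<and>
    (\<forall>s\<in>T. \<forall>t\<in>T. s \<noteq> t \<longrightarrow> interior (region s) \<inter> interior (region t) = {}) \<and>
    edge_to_edge T"

definition matching_rules :: "tile set \<Rightarrow> bool" where
  "matching_rules T \<longleftrightarrow>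
    (\<forall>s\<in>T. \<forall>t\<in>T. \<forall>u v. {u, v} \<in> edges s \<inter> edges t \<longrightarrow>
       ((u, v) \<in> arrows s \<longleftrightarrow> (u, v) \<in> arrows t))"

definition verts :: "tile set \<Rightarrow> complex set" where
  "verts T = (\<Union>t\<in>T. corners t)"

definition dir_edges :: "tile set \<Rightarrow> (complex \<times> complex) set" where
  "dir_edges T = {(u, v). \<exists>t\<in>T. {u, v} \<in> edges t}"

definition walk :: "tile set \<Rightarrow> (nat \<Rightarrow> complex) \<Rightarrow> nat \<Rightarrow> bool" where
  "walk T w m \<longleftrightarrow> w 0 \<in> verts T \<and> (\<forall>i<m. (w i, w (Suc i)) \<in> dir_edges T)"

section \<open>Ammann bars\<close>

definition ammann_normal :: "nat \<Rightarrow> complex" where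
  "ammann_normal k = cis (2 * pi * real k / 5)"

text \<open>
  A long edge, followed along its arrow, is crossed perpendicularly by one bar at the
  distance \<open>phi\<^sup>2/4\<close> from its tail (point \<open>P\<close>) and by two bars, both at angle
  \<open>3\<pi>/10\<close> to the edge, at the distance \<open>1/phi + phi/2\<close> (point \<open>X\<close>). A short edge
  is crossed by two bars, both at angle \<open>3\<pi>/10\<close>, at the distance \<open>phi/2\<close> from its tail
  (point \<open>Y\<close>). The fractions below are these distances divided by the edge length. These
  positions are forced by the requirement that the segments, perpendicular to edge directions,
  continue straight across matched edges and that no edge of a tile meets two segments of the
  same family.
\<close>

definition on_edge :: "real \<Rightarrow> complex \<Rightarrow> complex \<Rightarrow> complex" where
  "on_edge r p q = p + of_real r * (q - p)"

definition P_at :: "complex \<Rightarrow> complex \<Rightarrow> complex" where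
  "P_at = on_edge (phi / 4)"

definition X_at :: "complex \<Rightarrow> complex \<Rightarrow> complex" where
  "X_at = on_edge (5 / 2 - phi)"

definition Y_at :: "complex \<Rightarrow> complex \<Rightarrow> complex" where
  "Y_at = on_edge (phi / 2)"

definition bar_segments :: "tile \<Rightarrow> (complex \<times> complex) set" where
  "bar_segments t = (let a = cA t; b = cB t; c = cC t; d = cD t in
    case shape t of
      Kite \<Rightarrow> {(X_at a b, X_at a d),
               (P_at a b, Y_at c d), (P_at a d, Y_at c b),
               (X_at a b, Y_at c b), (X_at a d, Y_at c d)}
    | Dart \<Rightarrow> {(X_at b a, X_at d a),
               (P_at b a, Y_at b c), (P_at d a, Y_at d c),
               (X_at b a, Y_at d c), (X_at d a, Y_at b c)})"

definition local_segments :: "tile \<Rightarrow> complex \<Rightarrow> complex set set" where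
  "local_segments t n =
    {closed_segment p q | p q. (p, q) \<in> bar_segments t \<and> n \<bullet> (q - p) = 0}"

definition bars :: "tile set \<Rightarrow> complex \<Rightarrow> complex set set" where
  "bars T n = components (\<Union>t\<in>T. \<Union>(local_segments t n))"

section \<open>Bar-crossing function\<close>

definition dir_sign :: "complex \<Rightarrow> complex \<Rightarrow> complex \<Rightarrow> int" where
  "dir_sign n u v = (if n \<bullet> (v - u) > 0 then 1 else if n \<bullet> (v - u) < 0 then - 1 else 0)"

text \<open>
  The local segments end on the boundary of their tile, so a segment of the tile crosses
  an edge of it iff it meets the relative interior of that edge.
\<close>

definition tile_crossing :: "tile \<Rightarrow> complex \<Rightarrow> complex \<Rightarrow> complex \<Rightarrow> int" where
  "tile_crossing t n u v =
    (if \<exists>b\<in>local_segments t n. b \<inter> open_segment u v \<noteq> {} then dir_sign n u v else 0)"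

text \<open>
  The definite description makes the agreement of all tiles incident to the edge part of what
  has to be proved about \<open>bar_crossing\<close>.
\<close>

definition bar_crossing :: "tile set \<Rightarrow> complex \<Rightarrow> complex \<Rightarrow> complex \<Rightarrow> int" where
  "bar_crossing T n u v =
    (THE c. \<forall>t\<in>T. {u, v} \<in> edges t \<longrightarrow> tile_crossing t n u v = c)"

definition is_potential :: "tile set \<Rightarrow> complex \<Rightarrow> (complex \<Rightarrow> int) \<Rightarrow> bool" where
  "is_potential T n h \<longleftrightarrow> (\<forall>(u, v)\<in>dir_edges T. bar_crossing T n u v = h v - h u)"

section \<open>Classical height function\<close>

text \<open>
  \<open>bars_between T n u v\<close> are the bars that have \<open>u\<close> strictly on their \<open>- n\<close> side and \<open>v\<close>
  strictly on their \<open>n\<close> side. Both \<open>ammann_height\<close> and \<open>bars_crossed\<close> refer to the bars of the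
  whole tiling and not to the bar-crossing function.
\<close>

definition bars_between :: "tile set \<Rightarrow> complex \<Rightarrow> complex \<Rightarrow> complex \<Rightarrow> complex set set" where
  "bars_between T n u v = {b \<in> bars T n. \<forall>x\<in>b. n \<bullet> u < n \<bullet> x \<and> n \<bullet> x < n \<bullet> v}"

definition ammann_height :: "tile set \<Rightarrow> complex \<Rightarrow> complex \<Rightarrow> complex \<Rightarrow> int" where
  "ammann_height T n v0 v =
    int (card (bars_between T n v0 v)) - int (card (bars_between T n v v0))"

definition bars_crossed :: "tile set \<Rightarrow> complex \<Rightarrow> complex \<Rightarrow> complex \<Rightarrow> int" where
  "bars_crossed T n u v =
    dir_sign n u v * int (card {b \<in> bars T n. b \<inter> closed_segment u v \<noteq> {}})"

end

theory Submission
  imports Defs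
begin

text \<open>
  Every bar of the family is a whole line perpendicular to \<open>n\<close>, these lines form a discrete
  set, none of them contains a vertex, and every edge meets at most one of them. Hence the signed
  number of bar lines separating a base vertex from \<open>v\<close> changes along an edge by \<open>1\<close>, \<open>- 1\<close> or
  \<open>0\<close>, exactly as \<open>bar_crossing\<close> does, so this number is a potential. It is by definition the
  Ammann height. Cycle closure is the telescoping of a potential along a closed walk, and two
  potentials differ by a constant because the graph is connected.

  The geometry rests on one observation (\<open>crossing_points_are_bar_ends\<close>): where the bar segments of
  a tile end on one of its edges depends only on that edge as an arrow, not on the tile. An arrow
  of length \<open>phi\<close> carries the point \<open>P\<close>, where the bar is perpendicular to it, and the point \<open>X\<close>,
  where two bars pass whose normals make the angle \<open>\<pi>/5\<close> with the arrow; an arrow of length \<open>1\<close>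
  carries the point \<open>Y\<close>, with two bars of the latter kind. As no two of the normals at an edge are parallel, a
  single family uses at most one of these points. The matching rules say that both tiles at an edge
  see the same arrow, so the segments on both sides end at the same point, and being perpendicular
  to the same \<open>n\<close> they continue each other (\<open>bar_continues\<close>). On a line perpendicular to \<open>n\<close>
  the points lying on segments therefore form a set that is open and, by local finiteness of the
  tiling, closed; it is empty or the whole line (\<open>bar_points_level\<close>).

  That segments of different tiles do not interfere in any other way comes from the shape of the
  tiles: a bar segment runs in the interior of its tile and meets the boundary only at its two ends,
  which are not corners. Interiors being disjoint and edges meeting only in common corners, a bar
  segment of one tile can meet an edge of another only if the two tiles share that edge
  (\<open>bar_meets_edge\<close>).

  The metric facts are finite computations in \<open>\<rat>(phi)\<close>: with respect to the oblique basis formed by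
  the axis of a tile and the axis turned by \<open>\<pi>/5\<close>, all corners, bar ends and side lines have
  coordinates in this field, because \<open>cis (\<pi>/5)\<close> is a root of \<open>z\<^sup>2 - phi z + 1\<close>.
\<close>

section \<open>The golden ratio\<close>

text \<open>
  These two equations reduce every polynomial in \<open>phi\<close> to a linear one, after which linear
  arithmetic with \<open>phi_bounds\<close> decides the signs that occur below.
\<close>
lemma phi_mult: "phi * phi = phi + 1" "phi * (phi * x) = phi * x + x"
proof -
  show *: "phi * phi = phi + 1"
    by (simp add: phi_def field_simps)
  show "phi * (phi * x) = phi * x + x"
    by (metis * mult.assoc distrib_right mult_1)
qed

lemma phi_bounds: "809 / 500 < phi" "phi < 1619 / 1000"
proof -
  have "559 / 250 < sqrt 5"
    by (rule real_less_rsqrt) (simp add: power2_eq_square)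
  moreover have "sqrt 5 < 1119 / 500"
    by (rule real_less_lsqrt) (simp_all add: power2_eq_square)
  ultimately show "809 / 500 < phi" "phi < 1619 / 1000"
    by (simp_all add: phi_def)
qed

lemma phi_pos [simp]: "0 < phi" "0 \<le> phi" "phi \<noteq> 0" "\<not> phi \<le> 0"
  using phi_bounds by auto

lemma phi_mult_cancel: "y \<le> phi * y \<longleftrightarrow> 0 \<le> y" "phi * y \<le> y \<longleftrightarrow> y \<le> 0"
  using phi_bounds by (auto simp: mult_le_cancel_right1 mult_le_cancel_right2 not_less)

lemma phi_mono: "0 \<le> y \<Longrightarrow> y \<le> phi * y" "y \<le> 0 \<Longrightarrow> phi * y \<le> y"
  by (simp_all only: phi_mult_cancel)

text \<open>
  The angle \<open>x = \<pi>/5\<close> satisfies \<open>3 x = \<pi> - 2 x\<close>; expanding \<open>cos (3 x) = - cos (2 x)\<close> gives a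
  cubic for \<open>cos x\<close> with the root \<open>- 1\<close> and two roots \<open>(1 \<plusminus> sqrt 5) / 4\<close>, of which only one is
  positive.
\<close>
lemma cos_pi_5: "cos (pi / 5) = phi / 2"
proof -
  define c where "c = cos (pi / 5)"
  have "c > 0"
    unfolding c_def by (rule cos_gt_zero_pi) (use pi_gt_zero in linarith)+
  have "cos (3 * (pi / 5)) = - cos (pi - 3 * (pi / 5))"
    by (simp only: cos_pi_minus minus_minus)
  also have "pi - 3 * (pi / 5) = 2 * (pi / 5)"
    by simp
  finally have "4 * c ^ 3 - 3 * c = - (2 * c\<^sup>2 - 1)"
    by (simp only: cos_treble_cos cos_double_cos c_def)
  then have "(c + 1) * ((4 * c - 1)\<^sup>2 - 5) = 0"
    by (simp add: power2_eq_square power3_eq_cube algebra_simps)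
  then have "(4 * c - 1)\<^sup>2 = 5"
    using \<open>c > 0\<close> by simp
  then have "4 * c - 1 = sqrt 5 \<or> 4 * c - 1 = - sqrt 5"
    by (metis real_sqrt_abs abs_if minus_minus)
  moreover have "4 * c - 1 \<noteq> - sqrt 5"
  proof
    assume "4 * c - 1 = - sqrt 5"
    moreover have "1 < sqrt 5" by simp
    ultimately show False using \<open>c > 0\<close> by linarith
  qed
  ultimately show ?thesis
    by (simp add: phi_def c_def)
qed

lemma sin_pi_5_pos: "0 < sin (pi / 5)"
  by (rule sin_gt_zero) auto

lemma sin_pi_5_sq: "sin (pi / 5) * sin (pi / 5) = 3 / 4 - phi / 4"
  using sin_cos_squared_add[of "pi / 5"] phi_mult(1)
  by (simp add: cos_pi_5 power2_eq_square field_simps)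

section \<open>Coordinates adapted to a tile\<close>

text \<open>
  Coordinates with respect to an oblique basis. An orthonormal basis would bring in
  \<open>sin (\<pi>/5)\<close>, which does not lie in \<open>\<rat>(phi)\<close>.
\<close>
definition frame :: "tile \<Rightarrow> real \<Rightarrow> real \<Rightarrow> complex" where
  "frame t \<alpha> \<beta> = apex t + axis t * (of_real \<alpha> + of_real \<beta> * cis (pi / 5))"

lemma corners_frame:
  "cA t = frame t 0 0" "cB t = frame t 0 phi" "cD t = frame t (phi + 1) (- phi)"
  "shape t = Kite \<Longrightarrow> cC t = frame t phi 0"
  "shape t = Dart \<Longrightarrow> cC t = frame t 1 0"
proof -
  have "cis (- (pi / 5)) = of_real phi - cis (pi / 5)"
    by (simp add: complex_eq_iff cos_pi_5)
  then have "of_real phi * cis (- (pi / 5)) = of_real (phi * phi) - of_real phi * cis (pi / 5)"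
    by (simp only: of_real_mult right_diff_distrib)
  also have "\<dots> = of_real (phi + 1) + of_real (- phi) * cis (pi / 5)"
    unfolding phi_mult by simp
  finally show "cD t = frame t (phi + 1) (- phi)"
    unfolding cD_def frame_def by (metis mult.assoc mult.commute)
qed (simp_all add: cA_def cB_def cC_def frame_def mult_ac)

lemma frame_combine:
  "frame t a b + of_real r * (frame t c d - frame t a b)
     = frame t (a + r * (c - a)) (b + r * (d - b))"
  by (simp add: frame_def algebra_simps)

lemma on_edge_frame:
  "on_edge r (frame t a b) (frame t c d) = frame t (a + r * (c - a)) (b + r * (d - b))"
  by (simp add: on_edge_def frame_combine)

lemma norm_axis: "valid_tile t \<Longrightarrow> norm (axis t) = 1"
  by (metis valid_tile_def norm_one norm_power power_eq_1_iff norm_ge_zero zero_neq_numeral)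

lemma axis_nonzero: "valid_tile t \<Longrightarrow> axis t \<noteq> 0"
  using norm_axis by fastforce

lemma frame_inj:
  assumes "valid_tile t"
  shows "frame t a b = frame t c d \<longleftrightarrow> a = c \<and> b = d"
proof
  assume "frame t a b = frame t c d"
  then have *: "complex_of_real a + of_real b * cis (pi / 5) = of_real c + of_real d * cis (pi / 5)"
    using axis_nonzero[OF assms] by (simp add: frame_def)
  from arg_cong[OF *, of Im] have "b = d"
    using sin_pi_5_pos by simp
  with arg_cong[OF *, of Re] show "a = c \<and> b = d"
    by simp
qed simp

definition beta_coord :: "tile \<Rightarrow> complex \<Rightarrow> real" where
  "beta_coord t x = Im ((x - apex t) / axis t) / sin (pi / 5)"

definition alpha_coord :: "tile \<Rightarrow> complex \<Rightarrow> real" where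
  "alpha_coord t x = Re ((x - apex t) / axis t) - beta_coord t x * phi / 2"

lemma frame_coords:
  assumes "valid_tile t"
  shows "frame t (alpha_coord t x) (beta_coord t x) = x"
proof -
  have "complex_of_real (alpha_coord t x) + of_real (beta_coord t x) * cis (pi / 5)
      = (x - apex t) / axis t"
    using sin_pi_5_pos
    by (simp add: alpha_coord_def complex_eq_iff cos_pi_5 del: Re_divide Im_divide)
       (simp add: beta_coord_def)
  then show ?thesis
    using axis_nonzero[OF assms] by (simp add: frame_def)
qed

lemma frame_cases:
  assumes "valid_tile t"
  obtains \<alpha> \<beta> where "x = frame t \<alpha> \<beta>"
  using frame_coords[OF assms] by metis

lemma coords_frame:
  assumes "valid_tile t"
  shows "alpha_coord t (frame t \<alpha> \<beta>) = \<alpha>" "beta_coord t (frame t \<alpha> \<beta>) = \<beta>"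
  using frame_inj[OF assms] frame_coords[OF assms] by metis+

lemma continuous_on_coords [continuous_intros]:
  assumes "valid_tile t"
  shows "continuous_on S (alpha_coord t)" "continuous_on S (beta_coord t)"
  unfolding alpha_coord_def beta_coord_def
  using axis_nonzero[OF assms] sin_pi_5_pos by (intro continuous_intros; simp)+

section \<open>The region of a tile\<close>

text \<open>
  The first two inequalities are the half-planes bounded by the two long sides, the others those
  bounded by the short sides. The dart is not convex: its reflex corner makes the last two
  conditions alternatives.
\<close>
definition in_tile :: "shape \<Rightarrow> real \<Rightarrow> real \<Rightarrow> bool" where
  "in_tile s \<alpha> \<beta> \<longleftrightarrow> 0 \<le> \<alpha> \<and> 0 \<le> \<alpha> + phi * \<beta> \<and>
     (case s of Kite \<Rightarrow> \<alpha> + \<beta> \<le> phi \<and> phi * \<alpha> + \<beta> \<le> phi + 1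
      | Dart \<Rightarrow> phi * \<alpha> + \<beta> \<le> phi \<or> \<alpha> + \<beta> \<le> 1)"

definition inside_tile :: "shape \<Rightarrow> real \<Rightarrow> real \<Rightarrow> bool" where
  "inside_tile s \<alpha> \<beta> \<longleftrightarrow> 0 < \<alpha> \<and> 0 < \<alpha> + phi * \<beta> \<and>
     (case s of Kite \<Rightarrow> \<alpha> + \<beta> < phi \<and> phi * \<alpha> + \<beta> < phi + 1
      | Dart \<Rightarrow> phi * \<alpha> + \<beta> < phi \<or> \<alpha> + \<beta> < 1)"

lemma hull_frame:
  "convex hull {frame t 0 0, frame t a b, frame t c d}
     = {frame t (u * a + v * c) (u * b + v * d) | u v. 0 \<le> u \<and> 0 \<le> v \<and> u + v \<le> 1}"
  unfolding convex_hull_3_alt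
  by (intro Collect_cong ex_cong) (auto simp: frame_def scaleR_conv_of_real algebra_simps)

lemma in_frame_hull_iff:
  assumes "valid_tile t"
  shows "frame t x y \<in> convex hull {frame t 0 0, frame t a b, frame t c d} \<longleftrightarrow>
    (\<exists>u v. 0 \<le> u \<and> 0 \<le> v \<and> u + v \<le> 1 \<and> x = u * a + v * c \<and> y = u * b + v * d)"
  unfolding hull_frame using frame_inj[OF assms] by auto

lemma upper_half_iff:
  assumes "valid_tile t" and "0 < c"
  shows "frame t x y \<in> convex hull {frame t 0 0, frame t 0 phi, frame t c 0} \<longleftrightarrow>
     0 \<le> x \<and> 0 \<le> y \<and> phi * x + c * y \<le> c * phi"
proof -
  have le: "u + v \<le> 1 \<longleftrightarrow> phi * (v * c) + c * (u * phi) \<le> c * phi" for u v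
    using \<open>0 < c\<close> mult_le_cancel_left_pos[of "c * phi" "u + v" 1] by (simp add: algebra_simps)
  have "frame t x y \<in> convex hull {frame t 0 0, frame t 0 phi, frame t c 0} \<longleftrightarrow>
      (\<exists>u v. 0 \<le> u \<and> 0 \<le> v \<and> u + v \<le> 1 \<and> x = v * c \<and> y = u * phi)"
    unfolding in_frame_hull_iff[OF assms(1)] by simp
  also have "\<dots> \<longleftrightarrow> 0 \<le> x \<and> 0 \<le> y \<and> phi * x + c * y \<le> c * phi"
  proof (intro iffI; elim exE conjE)
    fix u v assume "0 \<le> u" "0 \<le> v" "u + v \<le> 1" "x = v * c" "y = u * phi"
    then show "0 \<le> x \<and> 0 \<le> y \<and> phi * x + c * y \<le> c * phi"
      using le \<open>0 < c\<close> by simp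
  next
    assume "0 \<le> x" "0 \<le> y" "phi * x + c * y \<le> c * phi"
    then show "\<exists>u v. 0 \<le> u \<and> 0 \<le> v \<and> u + v \<le> 1 \<and> x = v * c \<and> y = u * phi"
      using le[of "y / phi" "x / c"] \<open>0 < c\<close>
      by (intro exI[of _ "y / phi"] exI[of _ "x / c"]) simp
  qed
  finally show ?thesis .
qed

text \<open>
  The lower half of a tile is the mirror image of the upper one, but the basis is not
  symmetric, so its inequalities look different.
\<close>
lemma lower_half_iff:
  assumes "valid_tile t" and "0 < c"
  shows "frame t x y \<in> convex hull {frame t 0 0, frame t c 0, frame t (phi + 1) (- phi)} \<longleftrightarrow>
     y \<le> 0 \<and> 0 \<le> x + phi * y \<and> phi * x + (phi + 1 - c) * y \<le> c * phi"
  (is "?L \<longleftrightarrow> ?R")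
proof -
  have "?L \<longleftrightarrow> (\<exists>u v. 0 \<le> u \<and> 0 \<le> v \<and> u + v \<le> 1 \<and> x = u * c + v * (phi + 1) \<and> y = - v * phi)"
    unfolding in_frame_hull_iff[OF assms(1)] by simp
  also have "\<dots> \<longleftrightarrow> ?R"
  proof (intro iffI; elim exE conjE)
    fix u v assume *: "0 \<le> u" "0 \<le> v" "u + v \<le> 1" "x = u * c + v * (phi + 1)" "y = - v * phi"
    have "c * phi * (u + v) \<le> c * phi * 1"
      using * \<open>0 < c\<close> by (intro mult_left_mono) auto
    moreover have "x + phi * y = u * c"
      unfolding * by (simp add: algebra_simps phi_mult)
    ultimately show ?R
      using * \<open>0 < c\<close> by (simp add: algebra_simps phi_mult)
  next
    assume *: "y \<le> 0" "0 \<le> x + phi * y" "phi * x + (phi + 1 - c) * y \<le> c * phi"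
    have "c * phi * ((x + phi * y) / c + - y / phi) = phi * (x + phi * y) - c * y"
      using \<open>0 < c\<close> by (simp add: field_simps)
    also have "\<dots> \<le> c * phi * 1"
      using * by (simp add: algebra_simps phi_mult)
    finally have "c * phi * ((x + phi * y) / c + - y / phi) \<le> c * phi * 1" .
    then have "(x + phi * y) / c + - y / phi \<le> 1"
      by (rule mult_left_le_imp_le) (use \<open>0 < c\<close> in simp)
    moreover have "x = (x + phi * y) / c * c + (- y / phi) * (phi + 1)"
      using \<open>0 < c\<close> by (simp add: field_simps phi_mult)
    moreover have "y = - (- y / phi) * phi" "0 \<le> (x + phi * y) / c" "0 \<le> - y / phi"
      using * \<open>0 < c\<close> by (auto simp: divide_simps)
    ultimately show "\<exists>u v. 0 \<le> u \<and> 0 \<le> v \<and> u + v \<le> 1 \<and> x = u * c + v * (phi + 1) \<and> y = - v * phi"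
      by blast
  qed
  finally show ?thesis .
qed

text \<open>
  The two triangles are cut apart by the line \<open>\<beta> = 0\<close>, and in each of them the short side lying there
  decides: since \<open>phi > 1\<close>, its inequality implies that of the other short side in the kite and
  is implied by it in the dart.
\<close>
lemma region_iff:
  assumes "valid_tile t"
  shows "frame t \<alpha> \<beta> \<in> region t \<longleftrightarrow> in_tile (shape t) \<alpha> \<beta>"
proof (cases "shape t")
  case Kite
  have "phi * \<alpha> + phi * \<beta> \<le> phi * phi \<longleftrightarrow> \<alpha> + \<beta> \<le> phi"
    using mult_le_cancel_left_pos[of phi "\<alpha> + \<beta>" phi] by (simp add: distrib_left)
  then show ?thesis
    unfolding region_def corners_frame(1,2,3) corners_frame(4)[OF Kite]
      Un_iff upper_half_iff[OF assms phi_pos(1)] lower_half_iff[OF assms phi_pos(1)]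
    using phi_mono[of \<beta>] Kite unfolding in_tile_def phi_mult
    by (simp del: mult_le_cancel_right1 mult_le_cancel_right2 mult_le_cancel_left1 mult_le_cancel_left2) linarith
next
  case Dart
  have "phi * \<alpha> + phi * \<beta> \<le> phi * 1 \<longleftrightarrow> \<alpha> + \<beta> \<le> 1"
    using mult_le_cancel_left_pos[of phi "\<alpha> + \<beta>" 1] by (simp add: distrib_left)
  then show ?thesis
    unfolding region_def corners_frame(1,2,3) corners_frame(5)[OF Dart]
      Un_iff upper_half_iff[OF assms zero_less_one] lower_half_iff[OF assms zero_less_one]
    using phi_mono[of \<beta>] Dart unfolding in_tile_def phi_mult
    by (simp del: mult_le_cancel_right1 mult_le_cancel_right2 mult_le_cancel_left1 mult_le_cancel_left2) linarith
qed

lemma frame_diff: "frame t c d - frame t a b = axis t * (of_real (c - a) + of_real (d - b) * cis (pi / 5))"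
  by (simp add: frame_def algebra_simps)

text \<open>
  A point from which both the kite and the dart are star-shaped.
\<close>
definition center :: "tile \<Rightarrow> complex" where
  "center t = frame t (1 / 2) 0"

text \<open>
  Each linear form that bounds the tile is strictly on the good side at the center, so moving a
  point on or beyond a side line away from the center puts it strictly beyond.
\<close>
lemma not_in_tile_scaled:
  assumes "\<not> inside_tile s \<alpha> \<beta>" and "0 < e"
  shows "\<not> in_tile s (\<alpha> + e * (\<alpha> - 1 / 2)) (\<beta> + e * (\<beta> - 0))"
proof -
  have up: "c < f + e * (f - g)" if "c \<le> f" "g < c" for c f g :: real
  proof -
    have "0 < e * (f - g)" using that \<open>0 < e\<close> by simp
    with that show ?thesis by linarith
  qed
  have down: "f + e * (f - g) < c" if "f \<le> c" "c < g" for c f g :: real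
  proof -
    have "0 < e * (g - f)" using that \<open>0 < e\<close> by simp
    with that show ?thesis by (simp add: algebra_simps)
  qed
  let ?a = "\<alpha> + e * (\<alpha> - 1 / 2)" and ?b = "\<beta> + e * (\<beta> - 0)"
  have 1: "\<not> 0 \<le> ?a" if "\<not> 0 < \<alpha>"
    using down[of \<alpha> 0 "1/2"] that by simp
  have 2: "\<not> 0 \<le> ?a + phi * ?b" if "\<not> 0 < \<alpha> + phi * \<beta>"
    using down[of "\<alpha> + phi * \<beta>" 0 "1/2"] that by (simp add: algebra_simps)
  have 3: "\<not> ?a + ?b \<le> c" if "\<not> \<alpha> + \<beta> < c" "1/2 < c" for c
    using up[of c "\<alpha> + \<beta>" "1/2"] that by (simp add: algebra_simps)
  have 4: "\<not> phi * ?a + ?b \<le> c" if "\<not> phi * \<alpha> + \<beta> < c" "phi / 2 < c" for c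
    using up[of c "phi * \<alpha> + \<beta>" "phi/2"] that by (simp add: algebra_simps)
  have "1 / 2 < phi" "1 / 2 < (1::real)" "phi / 2 < phi + 1" "phi / 2 < phi"
    using phi_bounds by simp_all
  note 34 = 3[OF _ this(1)] 3[OF _ this(2)] 4[OF _ this(3)] 4[OF _ this(4)]
  show ?thesis
  proof (cases s)
    case Kite
    show ?thesis
      using assms(1) 1 2 34 unfolding inside_tile_def in_tile_def Kite shape.case by blast
  next
    case Dart
    show ?thesis
      using assms(1) 1 2 34 unfolding inside_tile_def in_tile_def Dart shape.case by blast
  qed
qed

lemma inside_tile_scaled:
  assumes "in_tile s \<alpha> \<beta>" and "0 < e" "e < 1"
  shows "inside_tile s (\<alpha> + e * (1 / 2 - \<alpha>)) (\<beta> + e * (0 - \<beta>))"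
proof -
  have up: "c < f + e * (g - f)" if "c \<le> f" "c < g" for c f g :: real
  proof -
    have "(1 - e) * c + e * c < (1 - e) * f + e * g"
      using assms that by (intro add_le_less_mono mult_left_mono mult_strict_left_mono) auto
    then show ?thesis by (simp add: algebra_simps)
  qed
  have down: "f + e * (g - f) < c" if "f \<le> c" "g < c" for c f g :: real
    using up[of "- c" "- f" "- g"] that by (simp add: algebra_simps)
  let ?a = "\<alpha> + e * (1 / 2 - \<alpha>)" and ?b = "\<beta> + e * (0 - \<beta>)"
  have 1: "0 < ?a" if "0 \<le> \<alpha>"
    using up[of 0 \<alpha> "1/2"] that by simp
  have 2: "0 < ?a + phi * ?b" if "0 \<le> \<alpha> + phi * \<beta>"
    using up[of 0 "\<alpha> + phi * \<beta>" "1/2"] that by (simp add: algebra_simps)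
  have 3: "?a + ?b < c" if "\<alpha> + \<beta> \<le> c" "1/2 < c" for c
    using down[of "\<alpha> + \<beta>" c "1/2"] that by (simp add: algebra_simps)
  have 4: "phi * ?a + ?b < c" if "phi * \<alpha> + \<beta> \<le> c" "phi / 2 < c" for c
    using down[of "phi * \<alpha> + \<beta>" c "phi/2"] that by (simp add: algebra_simps)
  have "1 / 2 < phi" "1 / 2 < (1::real)" "phi / 2 < phi + 1" "phi / 2 < phi"
    using phi_bounds by simp_all
  note 34 = 3[OF _ this(1)] 3[OF _ this(2)] 4[OF _ this(3)] 4[OF _ this(4)]
  show ?thesis
  proof (cases s)
    case Kite
    show ?thesis
      using assms(1) 1 2 34 unfolding inside_tile_def in_tile_def Kite shape.case by blast
  next
    case Dart
    show ?thesis
      using assms(1) 1 2 34 unfolding inside_tile_def in_tile_def Dart shape.case by blast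
  qed
qed

lemma inside_imp_in_tile: "inside_tile s \<alpha> \<beta> \<Longrightarrow> in_tile s \<alpha> \<beta>"
  by (cases s) (auto simp: inside_tile_def in_tile_def)

text \<open>
  With \<open>not_in_tile_scaled\<close> this shows that interior points satisfy all inequalities strictly.
\<close>
lemma interior_imp_overshoot:
  fixes x z :: complex
  assumes "x \<in> interior S"
  shows "\<exists>e>0. x + of_real e * (x - z) \<in> S"
proof -
  have "((\<lambda>e. x + of_real e * (x - z)) \<longlongrightarrow> x + of_real 0 * (x - z)) (at_right (0::real))"
    by (intro tendsto_intros)
  then have "\<forall>\<^sub>F e in at_right 0. x + of_real e * (x - z) \<in> interior S"
    by (rule topological_tendstoD) (use assms in auto)
  then have "\<forall>\<^sub>F e in at_right (0::real). 0 < e \<and> x + of_real e * (x - z) \<in> S"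
    using eventually_at_right_less[of "0::real"]
    by eventually_elim (use interior_subset in blast)
  then show ?thesis
    using eventually_happens'[OF trivial_limit_at_right_real] by blast
qed

lemma in_closure_if_approached:
  fixes x z :: complex
  assumes "\<And>e. 0 < e \<Longrightarrow> e < 1 \<Longrightarrow> x + of_real e * (z - x) \<in> S"
  shows "x \<in> closure S"
proof -
  have "((\<lambda>e. x + of_real e * (z - x)) \<longlongrightarrow> x + of_real 0 * (z - x)) (at_right (0::real))"
    by (intro tendsto_intros)
  then have lim: "((\<lambda>e. x + of_real e * (z - x)) \<longlongrightarrow> x) (at_right (0::real))"
    by simp
  have "\<forall>\<^sub>F e in at_right (0::real). e \<in> {0<..<1}"
    by (rule eventually_at_right_real) simp
  then have "\<forall>\<^sub>F e in at_right (0::real). x + of_real e * (z - x) \<in> closure S"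
    by eventually_elim (use assms closure_subset in auto)
  then show ?thesis
    by (intro Lim_in_closed_set[OF closed_closure _ trivial_limit_at_right_real lim])
qed

lemma open_inside:
  assumes "valid_tile t"
  shows "open {x. inside_tile (shape t) (alpha_coord t x) (beta_coord t x)}"
proof (cases "shape t")
  case Kite
  show ?thesis
    unfolding inside_tile_def Kite shape.case
    by (intro open_Collect_conj open_Collect_less continuous_intros assms)
next
  case Dart
  show ?thesis
    unfolding inside_tile_def Dart shape.case
    by (intro open_Collect_conj open_Collect_disj open_Collect_less continuous_intros assms)
qed

lemma interior_region_iff:
  assumes "valid_tile t"
  shows "frame t \<alpha> \<beta> \<in> interior (region t) \<longleftrightarrow> inside_tile (shape t) \<alpha> \<beta>"
proof
  assume "frame t \<alpha> \<beta> \<in> interior (region t)"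
  then obtain e :: real where e: "0 < e" "frame t \<alpha> \<beta> + of_real e * (frame t \<alpha> \<beta> - center t) \<in> region t"
    using interior_imp_overshoot by blast
  have "frame t \<alpha> \<beta> + of_real e * (frame t \<alpha> \<beta> - center t)
      = frame t (\<alpha> + e * (\<alpha> - 1 / 2)) (\<beta> + e * (\<beta> - 0))"
    by (simp add: center_def frame_def algebra_simps)
  then have "in_tile (shape t) (\<alpha> + e * (\<alpha> - 1 / 2)) (\<beta> + e * (\<beta> - 0))"
    using e(2) by (simp only: region_iff[OF assms])
  then show "inside_tile (shape t) \<alpha> \<beta>"
    using e(1) not_in_tile_scaled by blast
next
  let ?S = "{x. inside_tile (shape t) (alpha_coord t x) (beta_coord t x)}"
  assume "inside_tile (shape t) \<alpha> \<beta>"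
  then have "frame t \<alpha> \<beta> \<in> ?S"
    by (simp add: coords_frame[OF assms])
  moreover have "?S \<subseteq> region t"
  proof
    fix x assume "x \<in> ?S"
    then have "in_tile (shape t) (alpha_coord t x) (beta_coord t x)"
      by (simp add: inside_imp_in_tile)
    then show "x \<in> region t"
      by (simp only: region_iff[OF assms, symmetric] frame_coords[OF assms])
  qed
  ultimately show "frame t \<alpha> \<beta> \<in> interior (region t)"
    using open_inside[OF assms] interior_maximal by blast
qed

text \<open>
  Shrinking towards the center moves any point of the tile into the interior.
\<close>
lemma region_subset_closure_interior:
  assumes "valid_tile t"
  shows "region t \<subseteq> closure (interior (region t))"
proof
  fix x assume "x \<in> region t"
  moreover obtain \<alpha> \<beta> where x: "x = frame t \<alpha> \<beta>"
    using frame_cases[OF assms] .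
  ultimately have *: "in_tile (shape t) \<alpha> \<beta>"
    using region_iff[OF assms] by simp
  show "x \<in> closure (interior (region t))"
  proof (rule in_closure_if_approached[where z = "center t"])
    fix e :: real assume e: "0 < e" "e < 1"
    have "x + of_real e * (center t - x) = frame t (\<alpha> + e * (1 / 2 - \<alpha>)) (\<beta> + e * (0 - \<beta>))"
      by (simp add: x center_def frame_def algebra_simps)
    then show "x + of_real e * (center t - x) \<in> interior (region t)"
      using interior_region_iff[OF assms] inside_tile_scaled[OF * e] by simp
  qed
qed

lemma closed_region: "closed (region t)"
  unfolding region_def
  by (intro closed_Un compact_imp_closed finite_imp_compact_convex_hull) auto

section \<open>Edges\<close>

lemma edges_eq: "edges t = {{cA t, cB t}, {cA t, cD t}, {cC t, cB t}, {cC t, cD t}}"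
  by (cases "shape t") (auto simp: edges_def arrows_def insert_commute)

lemma closed_segment_frame:
  "closed_segment (frame t a b) (frame t c d)
     = {frame t (a + u * (c - a)) (b + u * (d - b)) | u. 0 \<le> u \<and> u \<le> 1}"
  unfolding closed_segment_def
  by (intro Collect_cong ex_cong) (auto simp: frame_def scaleR_conv_of_real algebra_simps)

lemma frame_in_segment:
  assumes "0 \<le> u" "u \<le> 1" "x = a + u * (c - a)" "y = b + u * (d - b)"
  shows "frame t x y \<in> convex hull {frame t a b, frame t c d}"
  unfolding segment_convex_hull[symmetric] closed_segment_frame using assms by blast

text \<open>
  Some inequality is an equality. Along the corresponding side the coordinate \<open>\<beta>\<close> runs from \<open>0\<close> to
  \<open>phi\<close> or from \<open>0\<close> to \<open>- phi\<close>, so \<open>\<plusminus> \<beta> / phi\<close> is the position on the edge, and the other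
  inequalities confine it to the unit interval.
\<close>
lemma boundary_imp_edge:
  assumes "valid_tile t" and "x \<in> region t" and "x \<notin> interior (region t)"
  shows "\<exists>e\<in>edges t. x \<in> convex hull e"
proof -
  obtain \<alpha> \<beta> where x: "x = frame t \<alpha> \<beta>"
    using frame_cases[OF assms(1)] .
  have in_t: "in_tile (shape t) \<alpha> \<beta>" and ninside: "\<not> inside_tile (shape t) \<alpha> \<beta>"
    using assms region_iff interior_region_iff by (auto simp: x)
  have up: "0 \<le> \<beta> / phi" "\<beta> / phi \<le> 1" if "0 \<le> \<beta>" "\<beta> \<le> phi"
    using that by (auto simp: divide_simps)
  have low: "0 \<le> - \<beta> / phi" "- \<beta> / phi \<le> 1" if "\<beta> \<le> 0" "- phi \<le> \<beta>"
    using that by (auto simp: divide_simps)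
  have mono: "0 \<le> \<beta> \<Longrightarrow> \<beta> \<le> phi * \<beta>" "\<beta> \<le> 0 \<Longrightarrow> phi * \<beta> \<le> \<beta>"
    using phi_mono by auto
  have A: "cA t = frame t 0 0" and B: "cB t = frame t 0 phi" and D: "cD t = frame t (phi + 1) (- phi)"
    by (simp_all add: corners_frame)
  show ?thesis
  proof (cases "shape t")
    case Kite
    have C: "cC t = frame t phi 0" by (simp add: corners_frame Kite)
    have ineq: "0 \<le> \<alpha>" "0 \<le> \<alpha> + phi * \<beta>" "\<alpha> + \<beta> \<le> phi" "phi * \<alpha> + \<beta> \<le> phi + 1"
      using in_t by (auto simp: in_tile_def Kite)
    consider "\<alpha> = 0" | "\<alpha> + phi * \<beta> = 0" | "\<alpha> + \<beta> = phi" | "phi * \<alpha> + \<beta> = phi + 1"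
      using ineq ninside by (fastforce simp: inside_tile_def Kite)
    then show ?thesis
    proof cases
      case 1
      with ineq mono have "0 \<le> \<beta>" "\<beta> \<le> phi" by (auto simp: zero_le_mult_iff)
      then have "x \<in> convex hull {cA t, cB t}"
        unfolding x A B using 1 up by (intro frame_in_segment[where u = "\<beta> / phi"]) auto
      then show ?thesis by (auto simp: edges_eq)
    next
      case 2
      then have \<alpha>: "\<alpha> = - (phi * \<beta>)" by simp
      have "0 \<le> phi * (- \<beta>)" "phi * (- \<beta>) \<le> phi * phi"
        using ineq unfolding \<alpha> by (simp_all add: phi_mult)
      then have "\<beta> \<le> 0" "- phi \<le> \<beta>"
        unfolding zero_le_mult_iff mult_le_cancel_left by auto
      then have "x \<in> convex hull {cA t, cD t}"
        unfolding x A D \<alpha> using low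
        by (intro frame_in_segment[where u = "- \<beta> / phi"]) (auto simp: field_simps phi_mult)
      then show ?thesis by (auto simp: edges_eq)
    next
      case 3
      then have \<alpha>: "\<alpha> = phi - \<beta>" by simp
      have "\<beta> \<le> phi * \<beta>" "\<beta> \<le> phi"
        using ineq unfolding \<alpha> by (simp_all add: phi_mult right_diff_distrib)
      then have "0 \<le> \<beta>" "\<beta> \<le> phi"
        by (simp_all only: phi_mult_cancel)
      then have "x \<in> convex hull {cC t, cB t}"
        unfolding x B C \<alpha> using up
        by (intro frame_in_segment[where u = "\<beta> / phi"]) (auto simp: field_simps)
      then show ?thesis by (auto simp: edges_eq)
    next
      case 4
      have "phi * (\<alpha> + \<beta>) \<le> phi * phi" "0 \<le> phi * (\<alpha> + phi * \<beta>)"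
        using ineq by (auto intro!: mult_left_mono mult_nonneg_nonneg)
      then have "phi * \<beta> \<le> \<beta>" "phi * (- phi) \<le> phi * \<beta>"
        using 4 by (simp_all add: phi_mult distrib_left)
      then have "\<beta> \<le> 0" "- phi \<le> \<beta>"
        unfolding phi_mult_cancel mult_le_cancel_left by auto
      moreover have "\<alpha> = (phi * phi - \<beta>) / phi"
        using 4 by (simp add: phi_mult field_simps)
      then have "\<alpha> = phi - \<beta> / phi"
        by (simp add: diff_divide_distrib)
      ultimately have "x \<in> convex hull {cC t, cD t}"
        unfolding x D C using low
        by (intro frame_in_segment[where u = "- \<beta> / phi"]) auto
      then show ?thesis by (auto simp: edges_eq)
    qed
  next
    case Dart
    have C: "cC t = frame t 1 0" by (simp add: corners_frame Dart)
    have ineq: "0 \<le> \<alpha>" "0 \<le> \<alpha> + phi * \<beta>" and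
      or: "phi * \<alpha> + \<beta> \<le> phi \<or> \<alpha> + \<beta> \<le> 1"
      using in_t by (auto simp: in_tile_def Dart)
    consider "\<alpha> = 0" | "\<alpha> + phi * \<beta> = 0" | "phi * \<alpha> + \<beta> = phi" "1 \<le> \<alpha> + \<beta>"
      | "\<alpha> + \<beta> = 1" "phi \<le> phi * \<alpha> + \<beta>"
      using ineq or ninside unfolding inside_tile_def Dart shape.case by linarith
    then show ?thesis
    proof cases
      case 1
      with ineq have "0 \<le> \<beta>" by (auto simp: zero_le_mult_iff)
      moreover have "\<beta> \<le> phi" using or 1 phi_bounds by auto
      ultimately have "x \<in> convex hull {cA t, cB t}"
        unfolding x A B using 1 up by (intro frame_in_segment[where u = "\<beta> / phi"]) auto
      then show ?thesis by (auto simp: edges_eq)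
    next
      case 2
      then have \<alpha>: "\<alpha> = - (phi * \<beta>)" by simp
      have "0 \<le> phi * (- \<beta>)"
        using ineq unfolding \<alpha> by simp
      then have "\<beta> \<le> 0"
        unfolding zero_le_mult_iff by auto
      moreover have "- phi \<le> \<beta>"
        using or
      proof
        assume "phi * \<alpha> + \<beta> \<le> phi"
        then have "phi * (- \<beta>) \<le> phi * 1"
          unfolding \<alpha> by (simp add: phi_mult)
        then have "- \<beta> \<le> 1"
          unfolding mult_le_cancel_left by auto
        then show ?thesis using phi_bounds by linarith
      next
        assume "\<alpha> + \<beta> \<le> 1"
        then have "phi * (\<alpha> + \<beta>) \<le> phi * 1"
          by (intro mult_left_mono) auto
        moreover have "phi * (\<alpha> + \<beta>) = - \<beta>"
          unfolding \<alpha> by (simp add: phi_mult distrib_left right_diff_distrib)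
        ultimately show ?thesis by simp
      qed
      ultimately have "x \<in> convex hull {cA t, cD t}"
        unfolding x A D \<alpha> using low
        by (intro frame_in_segment[where u = "- \<beta> / phi"]) (auto simp: field_simps phi_mult)
      then show ?thesis by (auto simp: edges_eq)
    next
      case 3
      have "phi * 1 \<le> phi * (\<alpha> + \<beta>)" "0 \<le> phi * \<alpha>"
        using 3 ineq by (auto intro!: mult_left_mono)
      then have "\<beta> \<le> phi * \<beta>" "\<beta> \<le> phi"
        using 3 by (simp_all add: distrib_left)
      then have "0 \<le> \<beta>" "\<beta> \<le> phi"
        by (simp_all only: phi_mult_cancel)
      moreover have "\<alpha> = (phi - \<beta>) / phi"
        using 3 by (simp add: field_simps)
      then have "\<alpha> = 1 - \<beta> / phi"
        by (simp add: diff_divide_distrib)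
      ultimately have "x \<in> convex hull {cC t, cB t}"
        unfolding x B C using up
        by (intro frame_in_segment[where u = "\<beta> / phi"]) auto
      then show ?thesis by (auto simp: edges_eq)
    next
      case 4
      then have \<alpha>: "\<alpha> = 1 - \<beta>" by simp
      have "0 \<le> phi * (\<alpha> + phi * \<beta>)"
        using ineq by auto
      then have "phi * \<beta> \<le> \<beta>" "- phi \<le> \<beta>"
        using 4 unfolding \<alpha> by (simp_all add: phi_mult distrib_left right_diff_distrib)
      then have "\<beta> \<le> 0" "- phi \<le> \<beta>"
        by (simp_all only: phi_mult_cancel)
      then have "x \<in> convex hull {cC t, cD t}"
        unfolding x C D \<alpha> using low
        by (intro frame_in_segment[where u = "- \<beta> / phi"]) (auto simp: field_simps)
      then show ?thesis by (auto simp: edges_eq)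
    qed
  qed
qed

text \<open>
  Along each edge the linear form of its side line takes its limiting value. On a short edge of the
  dart, where one alternative would be enough, the form of the other short side reaches its
  limit as well.
\<close>
lemma edge_not_inside:
  assumes "valid_tile t" and "e \<in> edges t" and "x \<in> convex hull e"
  shows "x \<in> region t" "x \<notin> interior (region t)"
proof -
  show "x \<in> region t"
  proof -
    have "convex hull e \<subseteq> region t"
      using assms(2) unfolding edges_eq region_def by (auto intro: subsetD[OF hull_mono, rotated])
    then show ?thesis using assms(3) by blast
  qed
  have seg: "x \<notin> interior (region t)"
    if "x \<in> convex hull {frame t a b, frame t c d}"
      and "\<And>u. 0 \<le> u \<Longrightarrow> \<not> inside_tile (shape t) (a + u * (c - a)) (b + u * (d - b))" for a b c d
    using that unfolding segment_convex_hull[symmetric] closed_segment_frame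
    by (auto simp: interior_region_iff[OF assms(1)])
  have u: "u \<le> u * phi" if "0 \<le> u" for u
    using phi_mono(1)[OF that] by (simp only: mult.commute)
  consider "e = {cA t, cB t}" | "e = {cA t, cD t}" | "e = {cC t, cB t}" | "e = {cC t, cD t}"
    using assms(2) by (auto simp: edges_eq)
  then show "x \<notin> interior (region t)"
  proof cases
    case 1
    from assms(3)[unfolded this corners_frame] show ?thesis
      by (rule seg) (simp add: inside_tile_def)
  next
    case 2
    from assms(3)[unfolded this corners_frame] show ?thesis
      by (rule seg) (simp add: inside_tile_def algebra_simps phi_mult)
  next
    case 3
    show ?thesis
    proof (cases "shape t")
      case Kite
      from assms(3)[unfolded 3 corners_frame(2) corners_frame(4)[OF Kite]] show ?thesis
        by (rule seg) (simp add: inside_tile_def Kite algebra_simps)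
    next
      case Dart
      from assms(3)[unfolded 3 corners_frame(2) corners_frame(5)[OF Dart]] show ?thesis
      proof (rule seg)
        show "\<not> inside_tile (shape t) (1 + w * (0 - 1)) (0 + w * (phi - 0))" if "0 \<le> w" for w
          using u[OF that] unfolding inside_tile_def Dart shape.case by (simp add: algebra_simps)
      qed
    qed
  next
    case 4
    show ?thesis
    proof (cases "shape t")
      case Kite
      from assms(3)[unfolded 4 corners_frame(3) corners_frame(4)[OF Kite]] show ?thesis
        by (rule seg) (simp add: inside_tile_def Kite algebra_simps phi_mult)
    next
      case Dart
      from assms(3)[unfolded 4 corners_frame(3) corners_frame(5)[OF Dart]] show ?thesis
        by (rule seg) (simp add: inside_tile_def Dart algebra_simps phi_mult)
    qed
  qed
qed

section \<open>Local finiteness of tilings\<close>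

lemma region_near_apex:
  assumes "valid_tile t"
  shows "region t \<subseteq> cball (apex t) 2"
proof -
  have "norm (of_real phi * axis t * cis x) \<le> 2" "norm (of_real phi * axis t) \<le> 2" for x
    using norm_axis[OF assms] phi_bounds by (simp_all add: norm_mult)
  then have "corners t \<subseteq> cball (apex t) 2"
    using norm_axis[OF assms]
    by (auto simp: corners_def cA_def cB_def cC_def cD_def dist_norm split: shape.split)
  then show ?thesis
    unfolding region_def corners_def by (intro Un_least hull_minimal convex_cball) auto
qed

text \<open>
  All tiles are images of two reference tiles under isometries that preserve the coordinates.
\<close>
lemma inradius:
  obtains r where "0 < r" "\<And>t. valid_tile t \<Longrightarrow> ball (center t) r \<subseteq> interior (region t)"
proof -
  have "\<exists>r>0. \<forall>t. valid_tile t \<and> shape t = s \<longrightarrow> ball (center t) r \<subseteq> interior (region t)" for s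
  proof -
    define t0 where "t0 = Tile s 0 1"
    have t0: "valid_tile t0" "shape t0 = s" by (simp_all add: t0_def valid_tile_def)
    have "inside_tile s (1 / 2) 0"
      using phi_bounds by (cases s) (auto simp: inside_tile_def)
    then have "center t0 \<in> interior (region t0)"
      unfolding center_def interior_region_iff[OF t0(1)] t0(2) .
    then obtain r where r: "0 < r" "ball (center t0) r \<subseteq> interior (region t0)"
      using open_contains_ball[of "interior (region t0)"] by auto
    have "x \<in> interior (region t)" if t: "valid_tile t" "shape t = s" and "x \<in> ball (center t) r" for t x
    proof -
      obtain \<alpha> \<beta> where x: "x = frame t \<alpha> \<beta>" using frame_cases[OF t(1)] .
      have "center t - x = axis t * (center t0 - frame t0 \<alpha> \<beta>)"
        by (simp add: x center_def frame_def t0_def algebra_simps)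
      then have "dist (center t) x = dist (center t0) (frame t0 \<alpha> \<beta>)"
        using norm_axis[OF t(1)] by (simp add: dist_norm norm_mult)
      then have "frame t0 \<alpha> \<beta> \<in> interior (region t0)"
        using r(2) \<open>x \<in> ball (center t) r\<close> by auto
      then show ?thesis
        by (simp add: x interior_region_iff t t0)
    qed
    then show ?thesis using r(1) by blast
  qed
  then obtain r where r: "\<And>s. 0 < r s"
    "\<And>s t. valid_tile t \<Longrightarrow> shape t = s \<Longrightarrow> ball (center t) (r s) \<subseteq> interior (region t)"
    by metis
  show ?thesis
  proof (rule that)
    show "0 < min (r Kite) (r Dart)" using r(1) by simp
    show "ball (center t) (min (r Kite) (r Dart)) \<subseteq> interior (region t)" if "valid_tile t" for t
      using r(2)[OF that refl] by (cases "shape t") auto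
  qed
qed

lemma P2_valid: "P2_tiling T \<Longrightarrow> t \<in> T \<Longrightarrow> valid_tile t"
  by (simp add: P2_tiling_def)

text \<open>
  The region of \<open>t\<close> lies in the closure of its interior, and a point of that closure which is
  interior to \<open>s\<close> would make the two interiors overlap.
\<close>
lemma interior_disjoint_region:
  assumes "P2_tiling T" "s \<in> T" "t \<in> T" "s \<noteq> t" "x \<in> interior (region s)"
  shows "x \<notin> region t"
proof
  assume "x \<in> region t"
  then have "x \<in> closure (interior (region t))"
    using region_subset_closure_interior P2_valid[OF assms(1,3)] by blast
  then have "interior (region s) \<inter> interior (region t) \<noteq> {}"
    using assms(5) open_Int_closure_eq_empty[OF open_interior] by blast
  then show False
    using assms(1-4) by (auto simp: P2_tiling_def)
qed

lemma center_in_interior: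
  assumes "valid_tile t"
  shows "center t \<in> interior (region t)"
  using inradius assms by (metis centre_in_ball subsetD)

text \<open>
  The centers of distinct tiles keep a fixed distance from each other, so only finitely many of
  them lie in a bounded set, and a tile is never far from its center.
\<close>
lemma finite_tiles_meeting:
  assumes "P2_tiling T"
  shows "finite {t \<in> T. region t \<inter> cball x R \<noteq> {}}" (is "finite ?F")
proof -
  obtain r where r: "0 < r" "\<And>t. valid_tile t \<Longrightarrow> ball (center t) r \<subseteq> interior (region t)"
    using inradius by blast
  have sep: "s = t" if "s \<in> T" "t \<in> T" "dist (center s) (center t) < r" for s t
  proof (rule ccontr)
    assume "s \<noteq> t"
    have "center t \<in> interior (region s)"
      using r(2)[OF P2_valid[OF assms that(1)]] that(3) by auto
    moreover have "center t \<in> region t"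
      using center_in_interior[OF P2_valid[OF assms that(2)]] interior_subset by blast
    ultimately show False
      using interior_disjoint_region[OF assms that(1,2) \<open>s \<noteq> t\<close>] by blast
  qed
  have "uniform_discrete (center ` ?F)"
    unfolding uniform_discrete_def using sep r(1) by (auto intro!: exI[of _ r])
  moreover have "center ` ?F \<subseteq> cball x (R + 4)"
  proof (rule image_subsetI)
    fix t assume "t \<in> ?F"
    then obtain y where t: "t \<in> T" and y: "y \<in> region t" "y \<in> cball x R"
      by blast
    have "y \<in> cball (apex t) 2" "center t \<in> cball (apex t) 2"
      using region_near_apex[OF P2_valid[OF assms t]] y(1)
        center_in_interior[OF P2_valid[OF assms t]] interior_subset by blast+
    then have "dist x y + dist (apex t) y + dist (apex t) (center t) \<le> R + 4"
      using y(2) by simp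
    moreover have "dist x (center t) \<le> dist x y + dist (apex t) y + dist (apex t) (center t)"
      using dist_triangle[of x "center t" y] dist_triangle[of y "center t" "apex t"]
      by (simp add: dist_commute)
    ultimately show "center t \<in> cball x (R + 4)" by simp
  qed
  then have "bounded (center ` ?F)"
    using bounded_cball bounded_subset by blast
  ultimately have "finite (center ` ?F)"
    using uniform_discrete_finite_iff by blast
  moreover have "inj_on center ?F"
    using sep r(1) by (auto intro!: inj_onI)
  ultimately show ?thesis
    by (rule finite_imageD)
qed

text \<open>
  An infinite union of closed sets is closed here because near each point only finitely many of
  them are present. It is used for unions of tiles as well as for the union of all bar segments.
\<close>
lemma closed_UN_tiles:
  assumes "P2_tiling T" "A \<subseteq> T" and K: "\<And>t. t \<in> A \<Longrightarrow> closed (K t) \<and> K t \<subseteq> region t"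
  shows "closed (\<Union>t\<in>A. K t)"
  unfolding closed_def
proof (subst open_subopen, intro ballI)
  fix x assume x: "x \<in> - (\<Union>t\<in>A. K t)"
  define F where "F = {t \<in> A. region t \<inter> cball x 1 \<noteq> {}}"
  have "finite F"
    by (rule finite_subset[OF _ finite_tiles_meeting[OF assms(1), of x 1]])
      (use assms(2) in \<open>auto simp: F_def\<close>)
  then have "open (ball x 1 - (\<Union>t\<in>F. K t))"
    by (intro open_Diff closed_UN ballI) (use K in \<open>auto simp: F_def\<close>)
  moreover have "ball x 1 - (\<Union>t\<in>F. K t) \<subseteq> - (\<Union>t\<in>A. K t)"
  proof
    fix y assume y: "y \<in> ball x 1 - (\<Union>t\<in>F. K t)"
    have "y \<notin> K t" if "t \<in> A" for t
    proof
      assume "y \<in> K t"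
      then have "y \<in> region t \<inter> cball x 1"
        using K[OF that] y by auto
      then have "t \<in> F" unfolding F_def using that by blast
      then show False using y \<open>y \<in> K t\<close> by blast
    qed
    then show "y \<in> - (\<Union>t\<in>A. K t)" by blast
  qed
  moreover have "x \<in> ball x 1 - (\<Union>t\<in>F. K t)"
    using x by (auto simp: F_def)
  ultimately show "\<exists>S. open S \<and> x \<in> S \<and> S \<subseteq> - (\<Union>t\<in>A. K t)" by blast
qed

section \<open>Bar segments\<close>

text \<open>
  The points at which the family with normal \<open>n\<close> crosses the arrow from \<open>p\<close> to \<open>q\<close>. No
  tile is mentioned: this is what makes two tiles at a common edge agree. Multiplication by \<open>\<i>\<close>
  turns a normal into the direction of its bars, so \<open>n \<bullet> (\<i> * (q - p) * \<zeta>) = 0\<close> says that \<open>n\<close> is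
  parallel to the arrow turned by \<open>\<zeta>\<close>. A length other than \<open>1\<close> stands for the long edges.
\<close>
definition crossing_points :: "complex \<Rightarrow> complex \<Rightarrow> complex \<Rightarrow> complex set" where
  "crossing_points n p q = {x.
     let w = \<i> * (q - p);
         oblique = n \<bullet> (w * cis (pi / 5)) = 0 \<or> n \<bullet> (w * cis (- (pi / 5))) = 0
     in if norm (q - p) = 1 then x = Y_at p q \<and> oblique
        else x = P_at p q \<and> n \<bullet> w = 0 \<or> x = X_at p q \<and> oblique}"

lemma crossing_points_alt:
  "norm (q - p) = 1 \<Longrightarrow> x \<in> crossing_points n p q \<longleftrightarrow> x = Y_at p q \<and>
     (n \<bullet> (\<i> * (q - p) * cis (pi / 5)) = 0 \<or> n \<bullet> (\<i> * (q - p) * cis (- (pi / 5))) = 0)"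
  "norm (q - p) \<noteq> 1 \<Longrightarrow> x \<in> crossing_points n p q \<longleftrightarrow>
     x = P_at p q \<and> n \<bullet> (\<i> * (q - p)) = 0 \<or> x = X_at p q \<and>
     (n \<bullet> (\<i> * (q - p) * cis (pi / 5)) = 0 \<or> n \<bullet> (\<i> * (q - p) * cis (- (pi / 5))) = 0)"
  by (simp_all add: crossing_points_def Let_def)

lemma inner_complex_axis:
  "n \<bullet> (a * (of_real x + of_real y * cis (pi / 5))) = x * (n \<bullet> a) + y * (n \<bullet> (a * cis (pi / 5)))"
proof -
  have "a * (of_real x + of_real y * cis (pi / 5)) = x *\<^sub>R a + y *\<^sub>R (a * cis (pi / 5))"
    by (simp add: scaleR_conv_of_real algebra_simps)
  then show ?thesis by (simp add: inner_add_right)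
qed

text \<open>
  The vector \<open>sin (\<pi>/5) * \<i>\<close> equals \<open>cis (\<pi>/5) - phi / 2\<close>. The extra factor \<open>sin (\<pi>/5)\<close> thus turns the
  rotation by a right angle into a map with coefficients in \<open>\<rat>(phi)\<close>.
\<close>
lemma inner_rotated:
  fixes n a :: complex and x y :: real
  defines "w \<equiv> a * (of_real x + of_real y * cis (pi / 5))"
  defines "N1 \<equiv> n \<bullet> a" and "N2 \<equiv> n \<bullet> (a * cis (pi / 5))"
  shows "sin (pi / 5) * (n \<bullet> (\<i> * w)) = (- y - phi * x / 2) * N1 + (x + phi * y / 2) * N2"
    "sin (pi / 5) * (n \<bullet> (\<i> * w * cis (pi / 5))) = (- x - phi * y / 2) * N1 + (phi * x / 2 + (phi - 1) / 2 * y) * N2"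
    "sin (pi / 5) * (n \<bullet> (\<i> * w * cis (- (pi / 5)))) = ((1 - phi) / 2 * x - phi * y / 2) * N1 + (phi * x / 2 + y) * N2"
proof -
  let ?z = "cis (pi / 5)" and ?s = "sin (pi / 5)"
  have s: "of_real ?s * \<i> = ?z - of_real (phi / 2)"
    by (simp add: complex_eq_iff cos_pi_5)
  have zz: "?z * ?z = of_real phi * ?z - 1"
    using sin_pi_5_sq by (simp add: complex_eq_iff cos_pi_5 phi_mult field_simps)
  have zc: "cis (- (pi / 5)) = of_real phi - ?z"
    by (simp add: complex_eq_iff cos_pi_5)
  have key: "?s * (n \<bullet> v) = c * N1 + d * N2"
    if "of_real ?s * v = a * (of_real c + of_real d * ?z)" for v c d
  proof -
    have "?s * (n \<bullet> v) = n \<bullet> (of_real ?s * v)"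
      by (simp add: scaleR_conv_of_real[symmetric])
    then show ?thesis
      unfolding that inner_complex_axis N1_def N2_def .
  qed
  have 1: "of_real ?s * (\<i> * w) = a * ((?z - of_real (phi / 2)) * (of_real x + of_real y * ?z))"
    unfolding s[symmetric] w_def by (simp add: mult_ac)
  also have "(?z - of_real (phi / 2)) * (of_real x + of_real y * ?z)
      = of_real x * ?z + of_real y * (?z * ?z) - of_real (phi / 2 * x) - of_real (phi / 2 * y) * ?z"
    by (simp add: algebra_simps)
  also have "\<dots> = of_real (- y - phi * x / 2) + of_real (x + phi * y / 2) * ?z"
    unfolding zz by (simp add: algebra_simps)
  finally have i: "of_real ?s * (\<i> * w) = a * (of_real (- y - phi * x / 2) + of_real (x + phi * y / 2) * ?z)" .
  then show "?s * (n \<bullet> (\<i> * w)) = (- y - phi * x / 2) * N1 + (x + phi * y / 2) * N2"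
    by (rule key)
  have up: "(of_real c + of_real d * ?z) * ?z = of_real (- d) + of_real (c + phi * d) * ?z" for c d
  proof -
    have "(of_real c + of_real d * ?z) * ?z = of_real c * ?z + of_real d * (?z * ?z)"
      by (simp add: algebra_simps)
    then show ?thesis unfolding zz by (simp add: algebra_simps)
  qed
  have down: "(of_real c + of_real d * ?z) * cis (- (pi / 5)) = of_real (phi * c + d) + of_real (- c) * ?z" for c d
  proof -
    have "(of_real c + of_real d * ?z) * cis (- (pi / 5))
        = of_real (c * phi) + of_real (d * phi - c) * ?z - of_real d * (?z * ?z)"
      unfolding zc by (simp add: algebra_simps)
    then show ?thesis unfolding zz by (simp add: algebra_simps)
  qed
  have "of_real ?s * (\<i> * w * v) = a * ((of_real (- y - phi * x / 2) + of_real (x + phi * y / 2) * ?z) * v)" for v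
    using arg_cong[OF i, of "\<lambda>u. u * v"] by (simp only: mult.assoc)
  note this[of ?z, unfolded up] this[of "cis (- (pi / 5))", unfolded down]
  from this[THEN key]
  show "sin (pi / 5) * (n \<bullet> (\<i> * w * cis (pi / 5))) = (- x - phi * y / 2) * N1 + (phi * x / 2 + (phi - 1) / 2 * y) * N2"
    "sin (pi / 5) * (n \<bullet> (\<i> * w * cis (- (pi / 5)))) = ((1 - phi) / 2 * x - phi * y / 2) * N1 + (phi * x / 2 + y) * N2"
    by (simp_all add: phi_mult field_simps)
qed

lemmas rotated_coords = frame_diff inner_complex_axis inner_rotated

text \<open>
  Perpendicularity to \<open>n\<close> only depends on the vector up to a factor. The factors \<open>r\<close> in the two
  tables below are the quotients of a bar segment by the rotated edge times \<open>sin (\<pi>/5)\<close>.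
\<close>
lemma perp_iff:
  assumes "n \<bullet> u = r * (sin (pi / 5) * (n \<bullet> v))" "r \<noteq> 0"
  shows "n \<bullet> u = 0 \<longleftrightarrow> n \<bullet> v = 0"
  using assms sin_pi_5_pos by auto

text \<open>
  Each of the five bar segments of a tile has two ends, and at each end its direction is
  compared with the arrow on which it ends: ten equivalences, two for every segment.
\<close>
lemma kite_perp:
  assumes "shape t = Kite"
  shows
    "n \<bullet> (X_at (cA t) (cD t) - X_at (cA t) (cB t)) = 0 \<longleftrightarrow> n \<bullet> (\<i> * (cB t - cA t) * cis (- (pi / 5))) = 0"
    "n \<bullet> (X_at (cA t) (cD t) - X_at (cA t) (cB t)) = 0 \<longleftrightarrow> n \<bullet> (\<i> * (cD t - cA t) * cis (pi / 5)) = 0"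
    "n \<bullet> (Y_at (cC t) (cD t) - P_at (cA t) (cB t)) = 0 \<longleftrightarrow> n \<bullet> (\<i> * (cB t - cA t)) = 0"
    "n \<bullet> (Y_at (cC t) (cD t) - P_at (cA t) (cB t)) = 0 \<longleftrightarrow> n \<bullet> (\<i> * (cD t - cC t) * cis (- (pi / 5))) = 0"
    "n \<bullet> (Y_at (cC t) (cB t) - P_at (cA t) (cD t)) = 0 \<longleftrightarrow> n \<bullet> (\<i> * (cD t - cA t)) = 0"
    "n \<bullet> (Y_at (cC t) (cB t) - P_at (cA t) (cD t)) = 0 \<longleftrightarrow> n \<bullet> (\<i> * (cB t - cC t) * cis (pi / 5)) = 0"
    "n \<bullet> (Y_at (cC t) (cB t) - X_at (cA t) (cB t)) = 0 \<longleftrightarrow> n \<bullet> (\<i> * (cB t - cA t) * cis (pi / 5)) = 0"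
    "n \<bullet> (Y_at (cC t) (cB t) - X_at (cA t) (cB t)) = 0 \<longleftrightarrow> n \<bullet> (\<i> * (cB t - cC t) * cis (- (pi / 5))) = 0"
    "n \<bullet> (Y_at (cC t) (cD t) - X_at (cA t) (cD t)) = 0 \<longleftrightarrow> n \<bullet> (\<i> * (cD t - cA t) * cis (- (pi / 5))) = 0"
    "n \<bullet> (Y_at (cC t) (cD t) - X_at (cA t) (cD t)) = 0 \<longleftrightarrow> n \<bullet> (\<i> * (cD t - cC t) * cis (pi / 5)) = 0"
  unfolding X_at_def P_at_def Y_at_def corners_frame(1,2,3) corners_frame(4)[OF assms] on_edge_frame
  apply (rule perp_iff[where r = "2 * phi - 5"], simp only: rotated_coords, simp add: field_simps phi_mult,
    use phi_bounds in simp)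
  apply (rule perp_iff[where r = "2 * phi - 5"], simp only: rotated_coords, simp add: field_simps phi_mult,
    use phi_bounds in simp)
  apply (rule perp_iff[where r = "- (3 / 2)"], simp only: rotated_coords, simp add: field_simps phi_mult,
    use phi_bounds in simp)
  apply (rule perp_iff[where r = "3 * phi / 2"], simp only: rotated_coords, simp add: field_simps phi_mult,
    use phi_bounds in simp)
  apply (rule perp_iff[where r = "3 / 2"], simp only: rotated_coords, simp add: field_simps phi_mult,
    use phi_bounds in simp)
  apply (rule perp_iff[where r = "- (3 * phi / 2)"], simp only: rotated_coords, simp add: field_simps phi_mult,
    use phi_bounds in simp)
  apply (rule perp_iff[where r = "3 - 2 * phi"], simp only: rotated_coords, simp add: field_simps phi_mult,
    use phi_bounds in simp)
  apply (rule perp_iff[where r = "phi - 2"], simp only: rotated_coords, simp add: field_simps phi_mult,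
    use phi_bounds in simp)
  apply (rule perp_iff[where r = "2 * phi - 3"], simp only: rotated_coords, simp add: field_simps phi_mult,
    use phi_bounds in simp)
  apply (rule perp_iff[where r = "2 - phi"], simp only: rotated_coords, simp add: field_simps phi_mult,
    use phi_bounds in simp)
  done

lemma dart_perp:
  assumes "shape t = Dart"
  shows
    "n \<bullet> (X_at (cD t) (cA t) - X_at (cB t) (cA t)) = 0 \<longleftrightarrow> n \<bullet> (\<i> * (cA t - cB t) * cis (- (pi / 5))) = 0"
    "n \<bullet> (X_at (cD t) (cA t) - X_at (cB t) (cA t)) = 0 \<longleftrightarrow> n \<bullet> (\<i> * (cA t - cD t) * cis (pi / 5)) = 0"
    "n \<bullet> (Y_at (cB t) (cC t) - P_at (cB t) (cA t)) = 0 \<longleftrightarrow> n \<bullet> (\<i> * (cA t - cB t)) = 0"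
    "n \<bullet> (Y_at (cB t) (cC t) - P_at (cB t) (cA t)) = 0 \<longleftrightarrow> n \<bullet> (\<i> * (cC t - cB t) * cis (- (pi / 5))) = 0"
    "n \<bullet> (Y_at (cD t) (cC t) - P_at (cD t) (cA t)) = 0 \<longleftrightarrow> n \<bullet> (\<i> * (cA t - cD t)) = 0"
    "n \<bullet> (Y_at (cD t) (cC t) - P_at (cD t) (cA t)) = 0 \<longleftrightarrow> n \<bullet> (\<i> * (cC t - cD t) * cis (pi / 5)) = 0"
    "n \<bullet> (Y_at (cD t) (cC t) - X_at (cB t) (cA t)) = 0 \<longleftrightarrow> n \<bullet> (\<i> * (cA t - cB t) * cis (pi / 5)) = 0"
    "n \<bullet> (Y_at (cD t) (cC t) - X_at (cB t) (cA t)) = 0 \<longleftrightarrow> n \<bullet> (\<i> * (cC t - cD t) * cis (- (pi / 5))) = 0"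
    "n \<bullet> (Y_at (cB t) (cC t) - X_at (cD t) (cA t)) = 0 \<longleftrightarrow> n \<bullet> (\<i> * (cA t - cD t) * cis (- (pi / 5))) = 0"
    "n \<bullet> (Y_at (cB t) (cC t) - X_at (cD t) (cA t)) = 0 \<longleftrightarrow> n \<bullet> (\<i> * (cC t - cB t) * cis (pi / 5)) = 0"
  unfolding X_at_def P_at_def Y_at_def corners_frame(1,2,3) corners_frame(5)[OF assms] on_edge_frame
  apply (rule perp_iff[where r = "2 * phi - 3"], simp only: rotated_coords, simp add: field_simps phi_mult,
    use phi_bounds in simp)
  apply (rule perp_iff[where r = "2 * phi - 3"], simp only: rotated_coords, simp add: field_simps phi_mult,
    use phi_bounds in simp)
  apply (rule perp_iff[where r = "1 / 2"], simp only: rotated_coords, simp add: field_simps phi_mult,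
    use phi_bounds in simp)
  apply (rule perp_iff[where r = "phi / 2"], simp only: rotated_coords, simp add: field_simps phi_mult,
    use phi_bounds in simp)
  apply (rule perp_iff[where r = "- (1 / 2)"], simp only: rotated_coords, simp add: field_simps phi_mult,
    use phi_bounds in simp)
  apply (rule perp_iff[where r = "- (phi / 2)"], simp only: rotated_coords, simp add: field_simps phi_mult,
    use phi_bounds in simp)
  apply (rule perp_iff[where r = "1"], simp only: rotated_coords, simp add: field_simps phi_mult,
    use phi_bounds in simp)
  apply (rule perp_iff[where r = "- phi"], simp only: rotated_coords, simp add: field_simps phi_mult,
    use phi_bounds in simp)
  apply (rule perp_iff[where r = "- 1"], simp only: rotated_coords, simp add: field_simps phi_mult,
    use phi_bounds in simp)
  apply (rule perp_iff[where r = "phi"], simp only: rotated_coords, simp add: field_simps phi_mult,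
    use phi_bounds in simp)
  done

lemma norm_axis_combination:
  assumes "norm a = 1"
  shows "(norm (a * (of_real x + of_real y * cis (pi / 5))))\<^sup>2 = x\<^sup>2 + phi * x * y + y\<^sup>2"
proof -
  have "(norm (of_real x + of_real y * cis (pi / 5)))\<^sup>2
      = (x + y * cos (pi / 5))\<^sup>2 + (y * sin (pi / 5))\<^sup>2"
    by (simp add: cmod_power2)
  also have "\<dots> = x\<^sup>2 + 2 * cos (pi / 5) * x * y + y\<^sup>2 * 1"
    unfolding power_mult_distrib sin_squared_eq by (simp add: power2_eq_square algebra_simps)
  finally show ?thesis
    using assms by (simp add: norm_mult cos_pi_5)
qed

lemma edge_lengths:
  assumes "valid_tile t"
  shows "norm (cB t - cA t) = phi" "norm (cD t - cA t) = phi"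
    "norm (cB t - cC t) = 1" "norm (cD t - cC t) = 1"
proof -
  have *: "norm (frame t c d - frame t a b) = l"
    if "(c - a)\<^sup>2 + phi * (c - a) * (d - b) + (d - b)\<^sup>2 = l\<^sup>2" "0 \<le> l" for a b c d l
    using that norm_axis_combination[OF norm_axis[OF assms], of "c - a" "d - b"]
    unfolding frame_diff by (simp add: power2_eq_iff_nonneg)
  show "norm (cB t - cA t) = phi" "norm (cD t - cA t) = phi"
    unfolding corners_frame
    by (rule *; simp add: power2_eq_square algebra_simps phi_mult)+
  show "norm (cB t - cC t) = 1" "norm (cD t - cC t) = 1"
    by (cases "shape t"; simp only: corners_frame; rule *; simp add: power2_eq_square algebra_simps phi_mult)+
qed

lemma edge_lengths_reversed:
  assumes "valid_tile t"
  shows "norm (cA t - cB t) = phi" "norm (cA t - cD t) = phi"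
    "norm (cC t - cB t) = 1" "norm (cC t - cD t) = 1"
  using edge_lengths[OF assms] by (simp_all add: norm_minus_commute)

text \<open>
  The same table arranged by edges, with the bar conditions that the crossing points stand
  for. In this form both sides of \<open>crossing_points_are_bar_ends\<close> consist of the same atoms.
\<close>
lemma kite_crossings:
  assumes "valid_tile t" "shape t = Kite"
  shows
    "x \<in> crossing_points n (cA t) (cB t) \<longleftrightarrow> x = P_at (cA t) (cB t) \<and> n \<bullet> (Y_at (cC t) (cD t) - P_at (cA t) (cB t)) = 0
      \<or> x = X_at (cA t) (cB t) \<and> (n \<bullet> (Y_at (cC t) (cB t) - X_at (cA t) (cB t)) = 0 \<or> n \<bullet> (X_at (cA t) (cD t) - X_at (cA t) (cB t)) = 0)" (is ?edge1)
    "x \<in> crossing_points n (cA t) (cD t) \<longleftrightarrow> x = P_at (cA t) (cD t) \<and> n \<bullet> (Y_at (cC t) (cB t) - P_at (cA t) (cD t)) = 0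
      \<or> x = X_at (cA t) (cD t) \<and> (n \<bullet> (X_at (cA t) (cD t) - X_at (cA t) (cB t)) = 0 \<or> n \<bullet> (Y_at (cC t) (cD t) - X_at (cA t) (cD t)) = 0)" (is ?edge2)
    "x \<in> crossing_points n (cC t) (cB t) \<longleftrightarrow> x = Y_at (cC t) (cB t) \<and>
      (n \<bullet> (Y_at (cC t) (cB t) - P_at (cA t) (cD t)) = 0 \<or> n \<bullet> (Y_at (cC t) (cB t) - X_at (cA t) (cB t)) = 0)" (is ?edge3)
    "x \<in> crossing_points n (cC t) (cD t) \<longleftrightarrow> x = Y_at (cC t) (cD t) \<and>
      (n \<bullet> (Y_at (cC t) (cD t) - X_at (cA t) (cD t)) = 0 \<or> n \<bullet> (Y_at (cC t) (cD t) - P_at (cA t) (cB t)) = 0)" (is ?edge4)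
proof -
  have long: "norm (cB t - cA t) \<noteq> 1" "norm (cD t - cA t) \<noteq> 1"
    using edge_lengths[OF assms(1)] phi_bounds by auto
  note C = crossing_points_alt(2)[OF long(1)] crossing_points_alt(2)[OF long(2)]
    crossing_points_alt(1)[OF edge_lengths(3)[OF assms(1)]] crossing_points_alt(1)[OF edge_lengths(4)[OF assms(1)]]
  note K = kite_perp[OF assms(2), of n]
  show ?edge1 unfolding C K(3) K(7) K(1) ..
  show ?edge2 unfolding C K(5) K(2) K(9) ..
  show ?edge3 unfolding C K(6) K(8) ..
  show ?edge4 unfolding C K(10) K(4) ..
qed

lemma dart_crossings:
  assumes "valid_tile t" "shape t = Dart"
  shows
    "x \<in> crossing_points n (cB t) (cA t) \<longleftrightarrow> x = P_at (cB t) (cA t) \<and> n \<bullet> (Y_at (cB t) (cC t) - P_at (cB t) (cA t)) = 0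
      \<or> x = X_at (cB t) (cA t) \<and> (n \<bullet> (Y_at (cD t) (cC t) - X_at (cB t) (cA t)) = 0 \<or> n \<bullet> (X_at (cD t) (cA t) - X_at (cB t) (cA t)) = 0)" (is ?edge1)
    "x \<in> crossing_points n (cD t) (cA t) \<longleftrightarrow> x = P_at (cD t) (cA t) \<and> n \<bullet> (Y_at (cD t) (cC t) - P_at (cD t) (cA t)) = 0
      \<or> x = X_at (cD t) (cA t) \<and> (n \<bullet> (X_at (cD t) (cA t) - X_at (cB t) (cA t)) = 0 \<or> n \<bullet> (Y_at (cB t) (cC t) - X_at (cD t) (cA t)) = 0)" (is ?edge2)
    "x \<in> crossing_points n (cB t) (cC t) \<longleftrightarrow> x = Y_at (cB t) (cC t) \<and>
      (n \<bullet> (Y_at (cB t) (cC t) - X_at (cD t) (cA t)) = 0 \<or> n \<bullet> (Y_at (cB t) (cC t) - P_at (cB t) (cA t)) = 0)" (is ?edge3)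
    "x \<in> crossing_points n (cD t) (cC t) \<longleftrightarrow> x = Y_at (cD t) (cC t) \<and>
      (n \<bullet> (Y_at (cD t) (cC t) - P_at (cD t) (cA t)) = 0 \<or> n \<bullet> (Y_at (cD t) (cC t) - X_at (cB t) (cA t)) = 0)" (is ?edge4)
proof -
  have long: "norm (cA t - cB t) \<noteq> 1" "norm (cA t - cD t) \<noteq> 1"
    using edge_lengths_reversed[OF assms(1)] phi_bounds by auto
  note C = crossing_points_alt(2)[OF long(1)] crossing_points_alt(2)[OF long(2)]
    crossing_points_alt(1)[OF edge_lengths_reversed(3)[OF assms(1)]]
    crossing_points_alt(1)[OF edge_lengths_reversed(4)[OF assms(1)]]
  note K = dart_perp[OF assms(2), of n]
  show ?edge1 unfolding C K(3) K(7) K(1) ..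
  show ?edge2 unfolding C K(5) K(2) K(9) ..
  show ?edge3 unfolding C K(10) K(4) ..
  show ?edge4 unfolding C K(6) K(8) ..
qed

text \<open>
  A long edge admits three bar directions and a short edge two. That makes ten per tile, matching
  one to one the ten ends of its five bar segments.
\<close>
lemma crossing_points_are_bar_ends:
  assumes "valid_tile t"
  shows "(\<exists>(p, q)\<in>arrows t. x \<in> crossing_points n p q) \<longleftrightarrow>
    (\<exists>(a, b)\<in>bar_segments t. n \<bullet> (b - a) = 0 \<and> (x = a \<or> x = b))"
proof (cases "shape t")
  case Kite
  show ?thesis
    unfolding arrows_def bar_segments_def Let_def Kite shape.case
    by (simp only: bex_simps prod.case kite_crossings[OF assms Kite]) blast
next
  case Dart
  show ?thesis
    unfolding arrows_def bar_segments_def Let_def Dart shape.case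
    by (simp only: bex_simps prod.case dart_crossings[OF assms Dart]) blast
qed

lemma crossing_point_in_open_segment:
  assumes "x \<in> crossing_points n p q" "p \<noteq> q"
  shows "x \<in> open_segment p q"
proof -
  have "on_edge r p q \<in> open_segment p q" if "0 < r" "r < 1" for r
    unfolding in_segment on_edge_def using assms(2) that
    by (auto intro!: exI[of _ r] simp: scaleR_conv_of_real algebra_simps)
  then have "P_at p q \<in> open_segment p q" "X_at p q \<in> open_segment p q" "Y_at p q \<in> open_segment p q"
    using phi_bounds by (simp_all add: P_at_def X_at_def Y_at_def)
  then show ?thesis
    using assms(1) by (auto simp: crossing_points_def Let_def split: if_splits)
qed

text \<open>
  The only conflict could be between \<open>P\<close> and \<open>X\<close> on a long edge. It would need \<open>n\<close> to be
  perpendicular to two non-parallel vectors.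
\<close>
lemma crossing_point_unique:
  assumes "x \<in> crossing_points n p q" "y \<in> crossing_points n p q" "p \<noteq> q" "n \<noteq> 0"
  shows "x = y"
proof -
  let ?w = "q - p"
  have False if 0: "n \<bullet> (\<i> * ?w) = 0" and z: "n \<bullet> (\<i> * ?w * \<zeta>) = 0" and "Im \<zeta> \<noteq> 0" for \<zeta>
  proof -
    have "\<i> * ?w * \<zeta> = Re \<zeta> *\<^sub>R (\<i> * ?w) - Im \<zeta> *\<^sub>R ?w"
      by (simp add: complex_eq_iff algebra_simps)
    then have w: "n \<bullet> ?w = 0"
      using 0 z \<open>Im \<zeta> \<noteq> 0\<close> by (simp add: inner_diff_right)
    \<comment> \<open>The vectors \<open>w\<close> and \<open>\<i> w\<close> are orthogonal and of equal length.\<close>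
    have "(n \<bullet> (\<i> * ?w))\<^sup>2 + (n \<bullet> ?w)\<^sup>2 = (norm n)\<^sup>2 * (norm ?w)\<^sup>2"
      unfolding cmod_power2 by (simp add: inner_complex_def power2_eq_square algebra_simps)
    then show False
      using 0 w assms(3,4) by simp
  qed
  moreover have "Im (cis (pi / 5)) \<noteq> 0" "Im (cis (- (pi / 5))) \<noteq> 0"
    using sin_pi_5_pos by auto
  ultimately have excl: "\<not> (n \<bullet> (\<i> * ?w * cis (pi / 5)) = 0 \<or> n \<bullet> (\<i> * ?w * cis (- (pi / 5))) = 0)"
    if "n \<bullet> (\<i> * ?w) = 0"
    using that by blast
  show ?thesis
  proof (cases "norm ?w = 1")
    case True
    then show ?thesis
      using assms(1,2) unfolding crossing_points_alt(1)[OF True] by simp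
  next
    case False
    show ?thesis
      using assms(1,2) excl unfolding crossing_points_alt(2)[OF False] by blast
  qed
qed

text \<open>
  A linear form that is nonnegative at both ends of a segment, and not zero at both, is positive
  in between.
\<close>
lemma pos_between:
  fixes f g u :: real
  assumes "0 \<le> f" "0 \<le> g" "0 < f + g" "0 < u" "u < 1"
  shows "0 < f + u * (g - f)"
proof -
  have "0 < (1 - u) * f + u * g"
  proof (cases "f = 0")
    case False
    then show ?thesis using assms by (intro add_pos_nonneg mult_pos_pos mult_nonneg_nonneg) auto
  qed (use assms in simp)
  then show ?thesis by (simp add: algebra_simps)
qed

lemma open_segment_frame:
  "x \<in> open_segment (frame t a b) (frame t c d)
     \<Longrightarrow> \<exists>u. 0 < u \<and> u < 1 \<and> x = frame t (a + u * (c - a)) (b + u * (d - b))"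
  unfolding in_segment by (auto simp: frame_def scaleR_conv_of_real algebra_simps)

lemma open_segment_interior_kite:
  assumes "valid_tile t" "shape t = Kite"
    and "0 \<le> a" "0 \<le> c" "0 < a + c"
    and "0 \<le> a + phi * b" "0 \<le> c + phi * d" "0 < (a + phi * b) + (c + phi * d)"
    and "0 \<le> phi - (a + b)" "0 \<le> phi - (c + d)" "0 < (phi - (a + b)) + (phi - (c + d))"
    and "0 \<le> phi + 1 - (phi * a + b)" "0 \<le> phi + 1 - (phi * c + d)"
      "0 < (phi + 1 - (phi * a + b)) + (phi + 1 - (phi * c + d))"
  shows "open_segment (frame t a b) (frame t c d) \<subseteq> interior (region t)"
proof
  fix x assume "x \<in> open_segment (frame t a b) (frame t c d)"
  then obtain u where u: "0 < u" "u < 1" and x: "x = frame t (a + u * (c - a)) (b + u * (d - b))"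
    using open_segment_frame by blast
  show "x \<in> interior (region t)"
    unfolding x interior_region_iff[OF assms(1)] inside_tile_def assms(2) shape.case
    using pos_between[OF assms(3-5) u] pos_between[OF assms(6-8) u] pos_between[OF assms(9-11) u]
      pos_between[OF assms(12-14) u]
    by (simp add: algebra_simps)
qed

text \<open>
  Linear interpolation gives positivity only for a fixed linear form, so in the dart one disjunct of
  \<open>inside_tile\<close> is kept along the whole segment; the last hypothesis says which.
\<close>
lemma open_segment_interior_dart:
  assumes "valid_tile t" "shape t = Dart"
    and "0 \<le> a" "0 \<le> c" "0 < a + c"
    and "0 \<le> a + phi * b" "0 \<le> c + phi * d" "0 < (a + phi * b) + (c + phi * d)"
    and "0 \<le> phi - (phi * a + b) \<and> 0 \<le> phi - (phi * c + d) \<and> 0 < (phi - (phi * a + b)) + (phi - (phi * c + d))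
       \<or> 0 \<le> 1 - (a + b) \<and> 0 \<le> 1 - (c + d) \<and> 0 < (1 - (a + b)) + (1 - (c + d))"
  shows "open_segment (frame t a b) (frame t c d) \<subseteq> interior (region t)"
proof
  fix x assume "x \<in> open_segment (frame t a b) (frame t c d)"
  then obtain u where u: "0 < u" "u < 1" and x: "x = frame t (a + u * (c - a)) (b + u * (d - b))"
    using open_segment_frame by blast
  from assms(9) show "x \<in> interior (region t)"
    unfolding x interior_region_iff[OF assms(1)] inside_tile_def assms(2) shape.case
  proof (elim disjE conjE)
    assume *: "0 \<le> phi - (phi * a + b)" "0 \<le> phi - (phi * c + d)"
      "0 < (phi - (phi * a + b)) + (phi - (phi * c + d))"
    show "0 < a + u * (c - a) \<and> 0 < a + u * (c - a) + phi * (b + u * (d - b)) \<and>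
      (phi * (a + u * (c - a)) + (b + u * (d - b)) < phi \<or> a + u * (c - a) + (b + u * (d - b)) < 1)"
      using pos_between[OF assms(3-5) u] pos_between[OF assms(6-8) u] pos_between[OF * u]
      by (simp add: algebra_simps)
  next
    assume *: "0 \<le> 1 - (a + b)" "0 \<le> 1 - (c + d)" "0 < (1 - (a + b)) + (1 - (c + d))"
    show "0 < a + u * (c - a) \<and> 0 < a + u * (c - a) + phi * (b + u * (d - b)) \<and>
      (phi * (a + u * (c - a)) + (b + u * (d - b)) < phi \<or> a + u * (c - a) + (b + u * (d - b)) < 1)"
      using pos_between[OF assms(3-5) u] pos_between[OF assms(6-8) u] pos_between[OF * u]
      by (simp add: algebra_simps)
  qed
qed

lemma bar_segment_interior:
  assumes "valid_tile t" "(p, q) \<in> bar_segments t"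
  shows "open_segment p q \<subseteq> interior (region t)"
proof (cases "shape t")
  case Kite
  note R = open_segment_interior_kite[OF assms(1) Kite]
  from assms(2) show ?thesis
    unfolding bar_segments_def Let_def Kite shape.case X_at_def P_at_def Y_at_def
      corners_frame(1,2,3) corners_frame(4)[OF Kite] on_edge_frame
    using phi_bounds
    by (elim insertE emptyE Pair_inject; hypsubst; intro R; simp add: field_simps phi_mult)
next
  case Dart
  note R = open_segment_interior_dart[OF assms(1) Dart]
  from assms(2) show ?thesis
    unfolding bar_segments_def Let_def Dart shape.case X_at_def P_at_def Y_at_def
      corners_frame(1,2,3) corners_frame(5)[OF Dart] on_edge_frame
    using phi_bounds
    by (elim insertE emptyE Pair_inject; hypsubst; intro R; simp add: field_simps phi_mult)
qed

lemma bar_segment_nondegenerate: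
  assumes "valid_tile t" "(p, q) \<in> bar_segments t"
  shows "p \<noteq> q"
proof (cases "shape t")
  case Kite
  from assms(2) show ?thesis
    unfolding bar_segments_def Let_def Kite shape.case X_at_def P_at_def Y_at_def
      corners_frame(1,2,3) corners_frame(4)[OF Kite] on_edge_frame
    using phi_bounds
    by (elim insertE emptyE Pair_inject; hypsubst; simp add: frame_inj[OF assms(1)] field_simps phi_mult)
next
  case Dart
  from assms(2) show ?thesis
    unfolding bar_segments_def Let_def Dart shape.case X_at_def P_at_def Y_at_def
      corners_frame(1,2,3) corners_frame(5)[OF Dart] on_edge_frame
    using phi_bounds
    by (elim insertE emptyE Pair_inject; hypsubst; simp add: frame_inj[OF assms(1)] field_simps phi_mult)
qed

lemma beta_corners:
  assumes "valid_tile t"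
  shows "beta_coord t (cA t) = 0" "beta_coord t (cB t) = phi"
    "beta_coord t (cC t) = 0" "beta_coord t (cD t) = - phi"
  by (cases "shape t"; simp add: corners_frame coords_frame[OF assms])+

text \<open>
  Heads and tails of arrows are told apart by \<open>\<bar>\<beta>\<bar>\<close>: it is \<open>0\<close> on the axis and \<open>phi\<close> at the other two
  corners. So an arrow is never reversed within its tile.
\<close>
lemma arrow_beta:
  assumes "valid_tile t" "(p, q) \<in> arrows t"
  shows "\<bar>beta_coord t p\<bar> = (if shape t = Kite then 0 else phi)"
    and "\<bar>beta_coord t q\<bar> = (if shape t = Kite then phi else 0)"
  using assms(2) by (cases "shape t"; auto simp: arrows_def beta_corners[OF assms(1)])+

lemma arrow_asym:
  assumes "valid_tile t" "(p, q) \<in> arrows t"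
  shows "(q, p) \<notin> arrows t" "p \<noteq> q"
  using arrow_beta[OF assms(1,2)] arrow_beta[OF assms(1), of q p]
  by (auto split: if_splits)

text \<open>
  Along an edge \<open>\<bar>\<beta>\<bar>\<close> runs strictly between the two values \<open>0\<close> and \<open>phi\<close> that it takes at corners.
\<close>
lemma open_edge_no_corner:
  assumes "valid_tile t" "(p, q) \<in> arrows t" "x \<in> open_segment p q"
  shows "x \<notin> corners t"
proof -
  obtain a b c d where p: "p = frame t a b" and q: "q = frame t c d"
    using frame_cases[OF assms(1)] by metis
  obtain u where u: "0 < u" "u < 1" and x: "x = frame t (a + u * (c - a)) (b + u * (d - b))"
    using open_segment_frame assms(3) unfolding p q by blast
  have beta: "beta_coord t x = b + u * (d - b)" "\<bar>b\<bar> = (if shape t = Kite then 0 else phi)"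
    "\<bar>d\<bar> = (if shape t = Kite then phi else 0)"
    using arrow_beta[OF assms(1,2)] by (simp_all add: x p q coords_frame[OF assms(1)])
  have "0 < \<bar>beta_coord t x\<bar>" "\<bar>beta_coord t x\<bar> < phi"
  proof -
    have "\<bar>beta_coord t x\<bar> = u * phi \<or> \<bar>beta_coord t x\<bar> = (1 - u) * phi"
    proof (cases "shape t")
      case Kite
      then have "beta_coord t x = u * d" "\<bar>d\<bar> = phi" using beta by simp_all
      then show ?thesis using u by (simp add: abs_mult)
    next
      case Dart
      then have "beta_coord t x = (1 - u) * b" "\<bar>b\<bar> = phi" using beta by (simp_all add: algebra_simps)
      then show ?thesis using u by (simp add: abs_mult)
    qed
    then show "0 < \<bar>beta_coord t x\<bar>" "\<bar>beta_coord t x\<bar> < phi"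
      using u by auto
  qed
  then show ?thesis
    by (auto simp: corners_def beta_corners[OF assms(1)])
qed

lemma bar_segment_subset_region:
  assumes "valid_tile t" "(p, q) \<in> bar_segments t"
  shows "closed_segment p q \<subseteq> region t"
proof -
  have "closed_segment p q = closure (open_segment p q)"
    using bar_segment_nondegenerate[OF assms] by simp
  also have "\<dots> \<subseteq> region t"
    using bar_segment_interior[OF assms] interior_subset closed_region
    by (intro closure_minimal) blast+
  finally show ?thesis .
qed

lemma finite_bar_segments: "finite (bar_segments t)"
  by (cases "shape t") (simp_all add: bar_segments_def Let_def)

lemma Union_local_segments:
  "x \<in> \<Union>(local_segments t n) \<longleftrightarrow>
     (\<exists>a b. (a, b) \<in> bar_segments t \<and> n \<bullet> (b - a) = 0 \<and> x \<in> closed_segment a b)"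
  by (auto simp: local_segments_def)

lemma closed_local_segments: "closed (\<Union>(local_segments t n))"
proof -
  have "\<Union>(local_segments t n) = (\<Union>(a, b)\<in>{(a, b) \<in> bar_segments t. n \<bullet> (b - a) = 0}. closed_segment a b)"
    unfolding local_segments_def by auto
  moreover have "finite {(a, b) \<in> bar_segments t. n \<bullet> (b - a) = 0}"
    by (rule finite_subset[OF _ finite_bar_segments[of t]]) auto
  ultimately show ?thesis
    by (auto intro!: closed_UN)
qed

lemma edges_arrow:
  "e \<in> edges t \<longleftrightarrow> (\<exists>p q. (p, q) \<in> arrows t \<and> e = {p, q})"
  by (auto simp: edges_def)

lemma edge_subset_corners: "e \<in> edges t \<Longrightarrow> e \<subseteq> corners t"
  by (auto simp: edges_eq corners_def)

lemma corner_on_edge: "v \<in> corners t \<Longrightarrow> \<exists>e\<in>edges t. v \<in> e"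
  by (auto simp: edges_eq corners_def)

section \<open>Bars crossing edges\<close>

text \<open>
  For a unit vector \<open>n\<close> the point \<open>c n\<close> has level \<open>c\<close>, and the lines perpendicular to \<open>n\<close> are
  parametrized by length along \<open>\<i> n\<close>.
\<close>
locale penrose_tiling =
  fixes T :: "tile set" and n :: complex
  assumes P2: "P2_tiling T" and rules: "matching_rules T" and unit: "norm n = 1"
begin

lemma valid: "t \<in> T \<Longrightarrow> valid_tile t"
  using P2_valid[OF P2] .

lemma cover: "\<exists>t\<in>T. x \<in> region t"
  using P2 by (auto simp: P2_tiling_def)

definition bar_points :: "complex set" where
  "bar_points = (\<Union>t\<in>T. \<Union>(local_segments t n))"

lemma mem_bar_points:
  "x \<in> bar_points \<longleftrightarrow>
     (\<exists>t a b. t \<in> T \<and> (a, b) \<in> bar_segments t \<and> n \<bullet> (b - a) = 0 \<and> x \<in> closed_segment a b)"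
  unfolding bar_points_def UN_iff Union_local_segments by blast

lemma bar_segment_subset_bar_points:
  assumes "t \<in> T" "(a, b) \<in> bar_segments t" "n \<bullet> (b - a) = 0"
  shows "closed_segment a b \<subseteq> bar_points"
  using assms mem_bar_points by blast

lemma edge_not_interior:
  assumes "s \<in> T" "t \<in> T" "e \<in> edges s" "x \<in> convex hull e"
  shows "x \<notin> interior (region t)"
proof (cases "s = t")
  case True
  then show ?thesis using edge_not_inside(2)[OF valid] assms by blast
next
  case False
  then show ?thesis
    using edge_not_inside(1)[OF valid assms(3,4)] interior_disjoint_region[OF P2 assms(2,1)] assms(1) by blast
qed

lemma edges_meet_in_corners:
  assumes "s \<in> T" "t \<in> T" "e \<in> edges s" "e' \<in> edges t" "x \<in> convex hull e" "x \<in> convex hull e'" "e \<noteq> e'"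
  shows "x \<in> corners s" "x \<in> corners t"
proof -
  have "edge_to_edge T" using P2 by (simp add: P2_tiling_def)
  from this[unfolded edge_to_edge_def, rule_format, OF assms(1-4,7)]
  show "x \<in> corners s" "x \<in> corners t" using assms(5,6) by blast+
qed

lemma shared_edge:
  assumes "s \<in> T" "t \<in> T" "e \<in> edges s" "x \<in> convex hull e" "x \<in> region t"
  shows "\<exists>e'\<in>edges t. x \<in> convex hull e' \<and> (e' = e \<or> x \<in> corners s \<inter> corners t)"
  using boundary_imp_edge[OF valid assms(5) edge_not_interior[OF assms(1-4)]]
    edges_meet_in_corners[OF assms(1,2,3) _ assms(4)] assms(2) by blast

lemma matching:
  assumes "s \<in> T" "t \<in> T" "(p, q) \<in> arrows s" "{p, q} \<in> edges t"
  shows "(p, q) \<in> arrows t"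
proof -
  have "{p, q} \<in> edges s \<inter> edges t"
    using assms edges_arrow by blast
  then show ?thesis
    using rules[unfolded matching_rules_def] assms(1-3) by blast
qed

lemma open_segment_subset_edge: "x \<in> open_segment p q \<Longrightarrow> x \<in> convex hull {p, q}"
  using segment_open_subset_closed by (auto simp: segment_convex_hull[symmetric])

text \<open>
  A point of an edge is interior to no tile, so it is an end of the segment and hence a crossing
  point of some edge of \<open>t\<close>. It is not a corner, so by the edge-to-edge property that edge
  is the given one.
\<close>
lemma bar_meets_edge:
  assumes "t \<in> T" "(a, b) \<in> bar_segments t" "n \<bullet> (b - a) = 0" "x \<in> closed_segment a b"
    and "s \<in> T" "e \<in> edges s" "x \<in> convex hull e"
  shows "\<exists>(p, q)\<in>arrows t. e = {p, q} \<and> x \<in> crossing_points n p q"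
proof -
  have "x \<notin> interior (region t)"
    using edge_not_interior assms by blast
  then have "x = a \<or> x = b"
    using assms(4) bar_segment_interior[OF valid[OF assms(1)] assms(2)] by (auto simp: open_segment_def)
  then obtain p q where pq: "(p, q) \<in> arrows t" "x \<in> crossing_points n p q"
    using crossing_points_are_bar_ends[OF valid[OF assms(1)]] assms(2,3) by blast
  have x: "x \<in> open_segment p q"
    using crossing_point_in_open_segment[OF pq(2)] arrow_asym(2)[OF valid[OF assms(1)] pq(1)] by blast
  have "x \<notin> corners t"
    using open_edge_no_corner[OF valid[OF assms(1)] pq(1) x] .
  moreover have "{p, q} \<in> edges t"
    using pq(1) edges_arrow by blast
  ultimately have "e = {p, q}"
    using edges_meet_in_corners(2)[OF assms(5,1,6) _ assms(7) open_segment_subset_edge[OF x]] by blast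
  then show ?thesis using pq by blast
qed

text \<open>
  By \<open>bar_meets_edge\<close> only tiles sharing the edge contribute to it, and by the matching rules they
  place the same arrow on it. A single tile at the edge therefore already accounts for all bar
  points there.
\<close>
lemma bar_points_on_arrow:
  assumes "s \<in> T" "(p, q) \<in> arrows s"
  shows "bar_points \<inter> closed_segment p q = crossing_points n p q"
    and "\<Union>(local_segments s n) \<inter> closed_segment p q = crossing_points n p q"
proof -
  have pq: "{p, q} \<in> edges s" using assms(2) edges_arrow by blast
  have 1: "bar_points \<inter> closed_segment p q \<subseteq> crossing_points n p q"
  proof
    fix x assume x: "x \<in> bar_points \<inter> closed_segment p q"
    then obtain t a b where t: "t \<in> T" "(a, b) \<in> bar_segments t" "n \<bullet> (b - a) = 0" "x \<in> closed_segment a b"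
      using mem_bar_points[of x] by blast
    have "x \<in> convex hull {p, q}"
      using x by (simp add: segment_convex_hull)
    from bar_meets_edge[OF t assms(1) pq this]
    obtain p' q' where *: "(p', q') \<in> arrows t" "{p, q} = {p', q'}" "x \<in> crossing_points n p' q'"
      by blast
    have "(p, q) \<in> arrows t"
      using matching[OF assms(1) t(1) assms(2)] * edges_arrow by metis
    then have "p' = p \<and> q' = q"
      using * arrow_asym(1)[OF valid[OF t(1)]] by (metis doubleton_eq_iff)
    then show "x \<in> crossing_points n p q" using * by simp
  qed
  have 2: "crossing_points n p q \<subseteq> \<Union>(local_segments s n) \<inter> closed_segment p q"
  proof
    fix x assume x: "x \<in> crossing_points n p q"
    then obtain a b where "(a, b) \<in> bar_segments s" "n \<bullet> (b - a) = 0" "x = a \<or> x = b"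
      using crossing_points_are_bar_ends[OF valid[OF assms(1)]] assms(2) by blast
    then have "x \<in> \<Union>(local_segments s n)"
      unfolding Union_local_segments by auto
    moreover have "x \<in> closed_segment p q"
      using crossing_point_in_open_segment[OF x] arrow_asym(2)[OF valid[OF assms(1)] assms(2)]
        segment_open_subset_closed by blast
    ultimately show "x \<in> \<Union>(local_segments s n) \<inter> closed_segment p q" by blast
  qed
  have 3: "\<Union>(local_segments s n) \<subseteq> bar_points"
    unfolding bar_points_def using assms(1) by blast
  show "bar_points \<inter> closed_segment p q = crossing_points n p q"
    using 1 2 3 by blast
  show "\<Union>(local_segments s n) \<inter> closed_segment p q = crossing_points n p q"
    using 1 2 3 by blast
qed

lemma bar_points_on_edge:
  assumes "t \<in> T" "{u, v} \<in> edges t"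
  shows "\<Union>(local_segments t n) \<inter> closed_segment u v = bar_points \<inter> closed_segment u v"
    and "bar_points \<inter> closed_segment u v \<subseteq> open_segment u v"
    and "x \<in> bar_points \<inter> closed_segment u v \<Longrightarrow> y \<in> bar_points \<inter> closed_segment u v \<Longrightarrow> x = y"
proof -
  obtain p q where pq: "(p, q) \<in> arrows t" "{u, v} = {p, q}"
    using assms(2) edges_arrow by blast
  have ne: "p \<noteq> q"
    using arrow_asym(2)[OF valid[OF assms(1)] pq(1)] .
  have seg: "closed_segment u v = closed_segment p q" "open_segment u v = open_segment p q"
    using pq(2) closed_segment_commute open_segment_commute by (metis doubleton_eq_iff)+
  note on = bar_points_on_arrow[OF assms(1) pq(1)]
  show "\<Union>(local_segments t n) \<inter> closed_segment u v = bar_points \<inter> closed_segment u v"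
    unfolding seg on ..
  show "bar_points \<inter> closed_segment u v \<subseteq> open_segment u v"
    unfolding seg on using crossing_point_in_open_segment ne by blast
  have "n \<noteq> 0" using unit by auto
  then show "x \<in> bar_points \<inter> closed_segment u v \<Longrightarrow> y \<in> bar_points \<inter> closed_segment u v \<Longrightarrow> x = y"
    unfolding seg on using crossing_point_unique ne by blast
qed

text \<open>
  The right-hand side does not mention a tile, which gives both the existence and the uniqueness
  that the definite description in \<open>bar_crossing\<close> asks for.
\<close>
lemma bar_crossing_eq:
  assumes "(u, v) \<in> dir_edges T"
  shows "bar_crossing T n u v = (if bar_points \<inter> closed_segment u v = {} then 0 else dir_sign n u v)"
proof -
  have "tile_crossing t n u v = (if bar_points \<inter> closed_segment u v = {} then 0 else dir_sign n u v)"
    if "t \<in> T" "{u, v} \<in> edges t" for t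
  proof -
    have "(\<exists>b\<in>local_segments t n. b \<inter> open_segment u v \<noteq> {}) \<longleftrightarrow> \<Union>(local_segments t n) \<inter> open_segment u v \<noteq> {}"
      by blast
    also have "\<dots> \<longleftrightarrow> bar_points \<inter> closed_segment u v \<noteq> {}"
      using bar_points_on_edge(1,2)[OF that] segment_open_subset_closed[of u v] by blast
    finally show ?thesis by (simp add: tile_crossing_def)
  qed
  moreover obtain t where "t \<in> T" "{u, v} \<in> edges t"
    using assms by (auto simp: dir_edges_def)
  ultimately show ?thesis
    unfolding bar_crossing_def by (intro the_equality) (blast, metis)
qed

section \<open>Bars are straight lines\<close>

lemma local_segments_subset_region: "t \<in> T \<Longrightarrow> \<Union>(local_segments t n) \<subseteq> region t"
  using bar_segment_subset_region[OF valid] Union_local_segments by blast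

lemma closed_bar_points: "closed bar_points"
  unfolding bar_points_def
  by (rule closed_UN_tiles[OF P2 order_refl]) (use closed_local_segments local_segments_subset_region in blast)

text \<open>
  Otherwise the remaining tiles, whose union is closed, would miss a neighbourhood of \<open>x\<close>, which
  would then be covered by \<open>t\<close> alone, although \<open>x\<close> is on its boundary.
\<close>
lemma neighbour_across:
  assumes "t \<in> T" "(p, q) \<in> arrows t" "x \<in> open_segment p q"
  shows "\<exists>s\<in>T. s \<noteq> t \<and> (p, q) \<in> arrows s"
proof -
  have e: "{p, q} \<in> edges t" using assms(2) edges_arrow by blast
  note x = open_segment_subset_edge[OF assms(3)]
  have "closed (\<Union>s\<in>T - {t}. region s)"
    by (rule closed_UN_tiles[OF P2]) (use closed_region in auto)
  then have "open (- (\<Union>s\<in>T - {t}. region s))" by (rule open_Compl)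
  moreover have "- (\<Union>s\<in>T - {t}. region s) \<subseteq> region t"
    using cover by blast
  ultimately have "- (\<Union>s\<in>T - {t}. region s) \<subseteq> interior (region t)"
    by (rule interior_maximal[rotated])
  then have "x \<in> (\<Union>s\<in>T - {t}. region s)"
    using edge_not_interior[OF assms(1,1) e x] by blast
  then obtain s where s: "s \<in> T" "s \<noteq> t" "x \<in> region s" by blast
  have "{p, q} \<in> edges s"
    using shared_edge[OF assms(1) s(1) e x s(3)] open_edge_no_corner[OF valid[OF assms(1)] assms(2,3)]
    by blast
  then show ?thesis
    using matching[OF assms(1) s(1) assms(2)] s by blast
qed

lemma bar_continues:
  assumes "t \<in> T" "(a, b) \<in> bar_segments t" "n \<bullet> (b - a) = 0" "x = a \<or> x = b"
  shows "\<exists>s a' b'. s \<in> T \<and> s \<noteq> t \<and> (a', b') \<in> bar_segments s \<and> n \<bullet> (b' - a') = 0 \<and> (x = a' \<or> x = b')"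
proof -
  obtain p q where pq: "(p, q) \<in> arrows t" "x \<in> crossing_points n p q"
    using crossing_points_are_bar_ends[OF valid[OF assms(1)]] assms(2-) by blast
  then have "x \<in> open_segment p q"
    using crossing_point_in_open_segment arrow_asym(2)[OF valid[OF assms(1)]] by blast
  then obtain s where s: "s \<in> T" "s \<noteq> t" "(p, q) \<in> arrows s"
    using neighbour_across[OF assms(1) pq(1)] by blast
  then show ?thesis
    using crossing_points_are_bar_ends[OF valid[OF s(1)], of x n] pq(2) by blast
qed

lemma level_line:
  assumes "n \<bullet> x = n \<bullet> y"
  shows "\<exists>r. y = x + of_real r * (\<i> * n)"
proof -
  define r where "r = Im (cnj n * (y - x))"
  have nn: "n * cnj n = 1"
    using unit by (simp add: complex_norm_square[symmetric])
  have "Re (cnj n * (y - x)) = 0"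
    using assms by (simp add: inner_complex_def algebra_simps)
  then have "cnj n * (y - x) = \<i> * of_real r"
    by (simp add: complex_eq_iff r_def)
  then have "n * cnj n * (y - x) = n * (\<i> * of_real r)"
    by (simp only: mult.assoc)
  then have "y - x = of_real r * (\<i> * n)"
    by (simp add: nn mult_ac)
  then show ?thesis by (intro exI[of _ r]) (simp add: algebra_simps)
qed

text \<open>
  On the line through \<open>x\<close> perpendicular to \<open>n\<close> the bar points form a closed and open set. Openness is
  clear inside a segment. At an end of a segment the segment of the neighbouring tile
  starts; it leaves in the opposite direction, since otherwise the two segments would overlap inside
  the disjoint interiors of the two tiles.
\<close>
lemma bar_points_level:
  assumes "x \<in> bar_points" "n \<bullet> x = n \<bullet> y"
  shows "y \<in> bar_points"
proof -
  define l where "l r = x + of_real r * (\<i> * n)" for r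
  have l_conv: "l ((1 - u) * r + u * r') = (1 - u) *\<^sub>R l r + u *\<^sub>R l r'" for u r r'
    by (simp add: l_def scaleR_conv_of_real algebra_simps)
  have l_inj: "l r = l r' \<longleftrightarrow> r = r'" for r r'
    using unit by (auto simp: l_def)
  have l_closed: "closed_segment (l r) (l r') = l ` closed_segment r r'" for r r'
    unfolding closed_segment_def by (auto simp: l_conv[symmetric])
  have l_open: "open_segment (l r) (l r') = l ` open_segment r r'" for r r'
    unfolding open_segment_def l_closed using l_inj by auto
  have l_level: "n \<bullet> l r = n \<bullet> x" for r
  proof -
    have "l r - x = r *\<^sub>R (\<i> * n)" by (simp add: l_def scaleR_conv_of_real)
    moreover have "n \<bullet> (\<i> * n) = 0" by (simp add: inner_complex_def)
    ultimately have "n \<bullet> (l r - x) = 0" by simp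
    then show ?thesis by (simp add: inner_diff_right)
  qed
  have on_line: "\<exists>r. z = l r" if "n \<bullet> z = n \<bullet> x" for z
    using level_line[of x z] that by (auto simp: l_def)
  have piece: "\<exists>r'. r' \<noteq> r \<and> open_segment (l r) (l r') \<subseteq> interior (region t)
        \<and> closed_segment (l r) (l r') \<subseteq> bar_points"
    if t: "t \<in> T" "(a, b) \<in> bar_segments t" "n \<bullet> (b - a) = 0" and r: "l r = a \<or> l r = b" for t a b r
  proof -
    \<comment> \<open>The end of the segment other than \<open>l r\<close>.\<close>
    define c where "c = (if l r = a then b else a)"
    have ab: "{a, b} = {l r, c}" "l r \<noteq> c"
      using r bar_segment_nondegenerate[OF valid[OF t(1)] t(2)] by (auto simp: c_def)
    have "n \<bullet> a = n \<bullet> b" using t(3) by (simp add: inner_diff_right)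
    then have "n \<bullet> c = n \<bullet> x" using r l_level[of r] by (auto simp: c_def)
    then obtain r' where r': "c = l r'" using on_line by blast
    have "a = l r \<and> b = l r' \<or> a = l r' \<and> b = l r"
      using ab(1) unfolding r' doubleton_eq_iff .
    then have seg: "open_segment (l r) (l r') = open_segment a b"
        "closed_segment (l r) (l r') = closed_segment a b"
      using open_segment_commute closed_segment_commute by metis+
    have "r' \<noteq> r" using ab(2) r' by blast
    moreover have "open_segment a b \<subseteq> interior (region t)"
      using bar_segment_interior[OF valid[OF t(1)] t(2)] .
    moreover have "closed_segment a b \<subseteq> bar_points"
      using bar_segment_subset_bar_points[OF t] .
    ultimately show ?thesis
      unfolding seg[symmetric] by blast
  qed
  define S where "S = {r. l r \<in> bar_points}"
  have "closed S"
  proof -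
    have "continuous_on UNIV l" unfolding l_def by (intro continuous_intros)
    then have "closed (l -` bar_points)"
      using closed_bar_points by (simp add: continuous_closed_vimage continuous_on_eq_continuous_at)
    then show ?thesis by (simp add: S_def vimage_def)
  qed
  moreover have "open S"
  proof (subst open_subopen, intro ballI)
    fix r assume "r \<in> S"
    then obtain t a b where t: "t \<in> T" "(a, b) \<in> bar_segments t" "n \<bullet> (b - a) = 0" "l r \<in> closed_segment a b"
      unfolding S_def mem_bar_points by blast
    have sub: "open_segment r1 r2 \<subseteq> S" if "closed_segment (l r1) (l r2) \<subseteq> bar_points" for r1 r2
      using that segment_open_subset_closed[of r1 r2] unfolding l_closed S_def by blast
    show "\<exists>U. open U \<and> r \<in> U \<and> U \<subseteq> S"
    proof (cases "l r = a \<or> l r = b")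
      case False
      have "n \<bullet> a = n \<bullet> l r"
      proof -
        obtain u where "l r = (1 - u) *\<^sub>R a + u *\<^sub>R b"
          using t(4) by (auto simp: in_segment)
        then have "l r - a = u *\<^sub>R (b - a)" by (simp add: algebra_simps)
        then have "n \<bullet> (l r - a) = 0" using t(3) by simp
        then show ?thesis by (simp add: inner_diff_right)
      qed
      then have lev: "n \<bullet> a = n \<bullet> x" "n \<bullet> b = n \<bullet> x"
        using l_level t(3) by (simp_all add: inner_diff_right)
      obtain ra rb where ab: "a = l ra" "b = l rb"
        using on_line[OF lev(1)] on_line[OF lev(2)] by blast
      have "r \<in> open_segment ra rb"
        using False t(4) unfolding ab l_closed l_inj by (auto simp: open_segment_def l_inj)
      moreover have "closed_segment (l ra) (l rb) \<subseteq> bar_points"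
        unfolding ab[symmetric] using bar_segment_subset_bar_points[OF t(1-3)] .
      ultimately show ?thesis
        using sub by (intro exI[of _ "open_segment ra rb"]) (auto simp: open_segment_eq_real_ivl)
    next
      case True
      obtain s a' b' where s: "s \<in> T" "s \<noteq> t" "(a', b') \<in> bar_segments s" "n \<bullet> (b' - a') = 0" "l r = a' \<or> l r = b'"
        using bar_continues[OF t(1-3) True] by blast
      obtain r1 where r1: "r1 \<noteq> r" "open_segment (l r) (l r1) \<subseteq> interior (region t)" "closed_segment (l r) (l r1) \<subseteq> bar_points"
        using piece[OF t(1-3) True] by blast
      obtain r2 where r2: "r2 \<noteq> r" "open_segment (l r) (l r2) \<subseteq> interior (region s)" "closed_segment (l r) (l r2) \<subseteq> bar_points"
        using piece[OF s(1,3-5)] by blast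
      have disj: "open_segment r r1 \<inter> open_segment r r2 = {}"
      proof -
        have "interior (region t) \<inter> interior (region s) = {}"
          using interior_disjoint_region[OF P2 t(1) s(1)] s(2) interior_subset by blast
        then have "open_segment (l r) (l r1) \<inter> open_segment (l r) (l r2) = {}"
          using r1(2) r2(2) by blast
        then show ?thesis unfolding l_open by blast
      qed
      have opposite: "r1 < r \<and> r < r2 \<or> r2 < r \<and> r < r1"
      proof (rule ccontr)
        assume "\<not> ?thesis"
        then consider "r < r1" "r < r2" | "r1 < r" "r2 < r"
          using r1(1) r2(1) by linarith
        then show False
        proof cases
          case 1
          then have "(r + min r1 r2) / 2 \<in> open_segment r r1 \<inter> open_segment r r2"
            by (auto simp: open_segment_eq_real_ivl min_def)
          then show False using disj by blast
        next
          case 2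
          then have "(r + max r1 r2) / 2 \<in> open_segment r r1 \<inter> open_segment r r2"
            by (auto simp: open_segment_eq_real_ivl max_def)
          then show False using disj by blast
        qed
      qed
      have "open_segment r1 r2 \<subseteq> S"
      proof
        fix z assume "z \<in> open_segment r1 r2"
        then have "z \<in> closed_segment r r1 \<or> z \<in> closed_segment r r2"
          using opposite by (auto simp: open_segment_eq_real_ivl closed_segment_eq_real_ivl split: if_splits)
        then show "z \<in> S"
          using r1(3) r2(3) unfolding l_closed S_def by blast
      qed
      moreover have "r \<in> open_segment r1 r2"
        using opposite by (auto simp: open_segment_eq_real_ivl)
      ultimately show ?thesis
        by (intro exI[of _ "open_segment r1 r2"]) (auto simp: open_segment_eq_real_ivl)
    qed
  qed
  moreover have "0 \<in> S" using assms(1) by (simp add: S_def l_def)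
  ultimately have "S = UNIV"
    using clopen by blast
  moreover obtain r where "y = l r" using on_line assms(2) by metis
  ultimately show ?thesis by (auto simp: S_def)
qed

definition levels :: "real set" where
  "levels = (\<lambda>x. n \<bullet> x) ` bar_points"

definition level_set :: "real \<Rightarrow> complex set" where
  "level_set c = {x. n \<bullet> x = c}"

lemma bar_points_iff: "x \<in> bar_points \<longleftrightarrow> n \<bullet> x \<in> levels"
  unfolding levels_def using bar_points_level by force

lemma inner_scaled_normal: "n \<bullet> (of_real c * n) = c"
proof -
  have "n \<bullet> (c *\<^sub>R n) = c * (n \<bullet> n)" by simp
  then show ?thesis using unit by (simp add: scaleR_conv_of_real dot_square_norm)
qed

lemma inj_level_set: "inj level_set"
proof (rule injI)
  fix c d assume "level_set c = level_set d"
  moreover have "of_real c * n \<in> level_set c"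
    by (simp add: level_set_def inner_scaled_normal)
  ultimately have "of_real c * n \<in> level_set d" by simp
  then show "c = d" by (simp add: level_set_def inner_scaled_normal)
qed

text \<open>
  Every bar line of level \<open>c\<close> passes through \<open>c n\<close>, so lines with levels in a bounded interval
  all come near the origin, where there are only finitely many bar segments.
\<close>
lemma finite_levels: "finite (levels \<inter> {a..b})"
proof -
  define R where "R = max \<bar>a\<bar> \<bar>b\<bar>"
  let ?F = "{t \<in> T. region t \<inter> cball 0 R \<noteq> {}}"
  have "levels \<inter> {a..b} \<subseteq> (\<lambda>(p, q). n \<bullet> p) ` (\<Union>t\<in>?F. bar_segments t)"
  proof
    fix c assume c: "c \<in> levels \<inter> {a..b}"
    let ?x = "of_real c * n"
    have "?x \<in> bar_points"
      using c bar_points_iff inner_scaled_normal by simp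
    then obtain t p q where t: "t \<in> T" "(p, q) \<in> bar_segments t" "n \<bullet> (q - p) = 0" "?x \<in> closed_segment p q"
      unfolding mem_bar_points by blast
    have "?x \<in> cball 0 R"
      using c unit by (auto simp: norm_mult R_def)
    then have "t \<in> ?F"
      using bar_segment_subset_region[OF valid[OF t(1)] t(2)] t(1,4) by blast
    moreover have "c = n \<bullet> p"
    proof -
      obtain u where "?x = (1 - u) *\<^sub>R p + u *\<^sub>R q" using t(4) by (auto simp: in_segment)
      then have "?x - p = u *\<^sub>R (q - p)" by (simp add: algebra_simps)
      then have "n \<bullet> (?x - p) = 0" using t(3) by simp
      then show ?thesis using inner_scaled_normal[of c] by (simp add: inner_diff_right)
    qed
    ultimately show "c \<in> (\<lambda>(p, q). n \<bullet> p) ` (\<Union>t\<in>?F. bar_segments t)"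
      using t(2) by force
  qed
  moreover have "finite (\<Union>t\<in>?F. bar_segments t)"
    using finite_tiles_meeting[OF P2] finite_bar_segments by blast
  ultimately show ?thesis
    using finite_subset by blast
qed

lemma connected_level_set: "connected (level_set c)"
  unfolding level_set_def by (intro convex_connected convex_hyperplane)

text \<open>
  The levels attained on a connected set form an interval, and an interval with finitely
  many points is a single point.
\<close>
lemma component_level:
  assumes "connected S" "S \<subseteq> bar_points" "x \<in> S" "y \<in> S"
  shows "n \<bullet> x = n \<bullet> y"
proof (rule ccontr)
  assume ne: "n \<bullet> x \<noteq> n \<bullet> y"
  have "connected ((\<lambda>x. n \<bullet> x) ` S)"
    by (intro connected_continuous_image continuous_intros assms(1))
  then have "closed_segment (n \<bullet> x) (n \<bullet> y) \<subseteq> (\<lambda>x. n \<bullet> x) ` S"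
    using assms(3,4) by (intro closed_segment_subset imageI) (simp_all only: connected_convex_1)
  also have "\<dots> \<subseteq> levels" using assms(2) by (auto simp: levels_def)
  finally have "closed_segment (n \<bullet> x) (n \<bullet> y) \<subseteq> levels \<inter> {min (n \<bullet> x) (n \<bullet> y)..max (n \<bullet> x) (n \<bullet> y)}"
    by (auto simp: closed_segment_eq_real_ivl split: if_splits)
  then have "finite (closed_segment (n \<bullet> x) (n \<bullet> y))"
    using finite_levels finite_subset by blast
  then show False using ne by (auto simp: closed_segment_eq_real_ivl infinite_Icc split: if_splits)
qed

lemma bars_eq: "bars T n = level_set ` levels"
proof -
  have comp: "connected_component_set bar_points x = level_set (n \<bullet> x)" if "x \<in> bar_points" for x
  proof
    show "connected_component_set bar_points x \<subseteq> level_set (n \<bullet> x)"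
    proof
      fix y assume "y \<in> connected_component_set bar_points x"
      moreover have "x \<in> connected_component_set bar_points x"
        using that by simp
      ultimately have "n \<bullet> y = n \<bullet> x"
        by (rule component_level[OF connected_connected_component connected_component_subset])
      then show "y \<in> level_set (n \<bullet> x)" by (simp add: level_set_def)
    qed
    show "level_set (n \<bullet> x) \<subseteq> connected_component_set bar_points x"
    proof (rule connected_component_maximal)
      show "x \<in> level_set (n \<bullet> x)" by (simp add: level_set_def)
      show "level_set (n \<bullet> x) \<subseteq> bar_points"
        using bar_points_level[OF that] by (auto simp: level_set_def)
    qed (rule connected_level_set)
  qed
  have "bars T n = connected_component_set bar_points ` bar_points"
    by (simp add: bars_def components_def bar_points_def)
  also have "\<dots> = level_set ` levels"
    unfolding levels_def image_image using comp by auto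
  finally show ?thesis .
qed

end

section \<open>Counting bars between vertices\<close>

definition signed_count :: "real set \<Rightarrow> real \<Rightarrow> real \<Rightarrow> int" where
  "signed_count C a b = int (card (C \<inter> {a<..<b})) - int (card (C \<inter> {b<..<a}))"

lemma signed_count_swap: "signed_count C b a = - signed_count C a b"
  by (simp add: signed_count_def)

lemma signed_count_add:
  assumes fin: "\<And>a b. finite (C \<inter> {a..b})" and "a \<notin> C" "b \<notin> C" "c \<notin> C"
  shows "signed_count C a c = signed_count C a b + signed_count C b c"
proof -
  have mono: "signed_count C x z = signed_count C x y + signed_count C y z"
    if "x \<le> y" "y \<le> z" "y \<notin> C" for x y z
  proof -
    have "C \<inter> {x<..<z} = (C \<inter> {x<..<y}) \<union> (C \<inter> {y<..<z})"
      using that by (auto simp: not_less order_less_le)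
    moreover have "finite (C \<inter> {x<..<y})" "finite (C \<inter> {y<..<z})"
      by (rule finite_subset[OF _ fin[of x y]], auto) (rule finite_subset[OF _ fin[of y z]], auto)
    moreover have "(C \<inter> {x<..<y}) \<inter> (C \<inter> {y<..<z}) = {}" by auto
    ultimately have "card (C \<inter> {x<..<z}) = card (C \<inter> {x<..<y}) + card (C \<inter> {y<..<z})"
      by (simp add: card_Un_disjoint)
    then show ?thesis using that by (simp add: signed_count_def)
  qed
  consider "a \<le> b" "b \<le> c" | "a \<le> c" "c \<le> b" | "b \<le> a" "a \<le> c"
    | "b \<le> c" "c \<le> a" | "c \<le> a" "a \<le> b" | "c \<le> b" "b \<le> a"
    by linarith
  then show ?thesis
  proof cases
    case 1 then show ?thesis using mono assms(3) by blast
  next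
    case 2 then show ?thesis using mono[of a c b] assms(4) signed_count_swap[of C b c] by simp
  next
    case 3 then show ?thesis using mono[of b a c] assms(2) signed_count_swap[of C a b] by simp
  next
    case 4 then show ?thesis using mono[of b c a] assms(4) signed_count_swap[of C a b] signed_count_swap[of C a c] by simp
  next
    case 5 then show ?thesis using mono[of c a b] assms(2) signed_count_swap[of C b c] signed_count_swap[of C a c] by simp
  next
    case 6 then show ?thesis
      using mono[of c b a] assms(3) signed_count_swap[of C a b] signed_count_swap[of C a c] signed_count_swap[of C b c] by simp
  qed
qed

context penrose_tiling
begin

text \<open>
  A vertex is an end of some edge, while bars cross edges at relatively interior points.
\<close>
lemma vertex_not_level:
  assumes "v \<in> verts T"
  shows "n \<bullet> v \<notin> levels"
proof
  assume "n \<bullet> v \<in> levels"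
  then have "v \<in> bar_points" using bar_points_iff by blast
  then obtain t a b where t: "t \<in> T" "(a, b) \<in> bar_segments t" "n \<bullet> (b - a) = 0" "v \<in> closed_segment a b"
    unfolding mem_bar_points by blast
  obtain s where s: "s \<in> T" "v \<in> corners s" using assms by (auto simp: verts_def)
  obtain e where e: "e \<in> edges s" "v \<in> e" using corner_on_edge[OF s(2)] by blast
  have "v \<in> convex hull e" using e(2) by (rule hull_inc)
  from bar_meets_edge[OF t s(1) e(1) this]
  obtain p q where pq: "(p, q) \<in> arrows t" "e = {p, q}" "v \<in> crossing_points n p q" by blast
  have "v \<in> open_segment p q"
    using crossing_point_in_open_segment[OF pq(3)] arrow_asym(2)[OF valid[OF t(1)] pq(1)] by blast
  then show False using e(2) pq(2) by (auto simp: open_segment_def)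
qed

lemma dir_edge_verts: "(u, v) \<in> dir_edges T \<Longrightarrow> u \<in> verts T \<and> v \<in> verts T"
  unfolding dir_edges_def verts_def using edge_subset_corners by blast

lemma ammann_height_eq: "ammann_height T n u v = signed_count levels (n \<bullet> u) (n \<bullet> v)"
proof -
  have "card (bars_between T n x y) = card (levels \<inter> {n \<bullet> x<..<n \<bullet> y})" for x y
  proof -
    have ne: "\<exists>z. z \<in> level_set c" for c
      using inner_scaled_normal[of c] by (auto simp: level_set_def)
    have "bars_between T n x y = level_set ` (levels \<inter> {n \<bullet> x<..<n \<bullet> y})"
    proof
      show "bars_between T n x y \<subseteq> level_set ` (levels \<inter> {n \<bullet> x<..<n \<bullet> y})"
      proof
        fix b assume "b \<in> bars_between T n x y"
        then obtain c where c: "c \<in> levels" "b = level_set c"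
          and btw: "\<forall>z\<in>b. n \<bullet> x < n \<bullet> z \<and> n \<bullet> z < n \<bullet> y"
          unfolding bars_between_def bars_eq by blast
        obtain z where "z \<in> level_set c" using ne by blast
        then have "c \<in> {n \<bullet> x<..<n \<bullet> y}"
          using btw unfolding c(2) by (auto simp: level_set_def)
        then show "b \<in> level_set ` (levels \<inter> {n \<bullet> x<..<n \<bullet> y})" using c by blast
      qed
      show "level_set ` (levels \<inter> {n \<bullet> x<..<n \<bullet> y}) \<subseteq> bars_between T n x y"
        unfolding bars_between_def bars_eq by (auto simp: level_set_def)
    qed
    then show ?thesis
      using card_image[OF inj_on_subset[OF inj_level_set subset_UNIV]] by simp
  qed
  then show ?thesis by (simp add: ammann_height_def signed_count_def)
qed

lemma level_reached:
  assumes "c \<in> closed_segment (n \<bullet> u) (n \<bullet> v)"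
  shows "\<exists>x\<in>closed_segment u v. n \<bullet> x = c"
proof -
  obtain r where r: "0 \<le> r" "r \<le> 1" "c = (1 - r) *\<^sub>R (n \<bullet> u) + r *\<^sub>R (n \<bullet> v)"
    using assms by (auto simp: in_segment)
  then have "n \<bullet> ((1 - r) *\<^sub>R u + r *\<^sub>R v) = c"
    by (simp add: inner_add_right)
  moreover have "(1 - r) *\<^sub>R u + r *\<^sub>R v \<in> closed_segment u v"
    using r by (auto simp: in_segment)
  ultimately show ?thesis by blast
qed

text \<open>
  The lines that separate the end points of an edge are those that meet it, because a bar
  contains every point of its level.
\<close>
lemma levels_on_edge:
  assumes "(u, v) \<in> dir_edges T"
  shows "levels \<inter> closed_segment (n \<bullet> u) (n \<bullet> v) = (\<lambda>x. n \<bullet> x) ` (bar_points \<inter> closed_segment u v)"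
proof
  show "levels \<inter> closed_segment (n \<bullet> u) (n \<bullet> v) \<subseteq> (\<lambda>x. n \<bullet> x) ` (bar_points \<inter> closed_segment u v)"
    using level_reached bar_points_iff by blast
  have "n \<bullet> x \<in> closed_segment (n \<bullet> u) (n \<bullet> v)" if "x \<in> closed_segment u v" for x
    using that unfolding in_segment by (auto simp: inner_add_right)
  then show "(\<lambda>x. n \<bullet> x) ` (bar_points \<inter> closed_segment u v) \<subseteq> levels \<inter> closed_segment (n \<bullet> u) (n \<bullet> v)"
    using bar_points_iff by blast
qed

lemma card_bar_points_on_edge:
  assumes "(u, v) \<in> dir_edges T"
  shows "card ((\<lambda>x. n \<bullet> x) ` (bar_points \<inter> closed_segment u v))
    = (if bar_points \<inter> closed_segment u v = {} then 0 else 1)"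
proof -
  obtain t where t: "t \<in> T" "{u, v} \<in> edges t" using assms by (auto simp: dir_edges_def)
  show ?thesis
  proof (cases "bar_points \<inter> closed_segment u v = {}")
    case False
    then obtain x where "x \<in> bar_points \<inter> closed_segment u v" by blast
    then have "bar_points \<inter> closed_segment u v = {x}"
      using bar_points_on_edge(3)[OF t] by blast
    then show ?thesis by simp
  qed simp
qed

text \<open>
  If the edge is perpendicular to \<open>n\<close> both sides vanish. Otherwise the bar points on the edge correspond
  to the levels strictly between its ends, and there is at most one.
\<close>
lemma signed_count_edge:
  assumes "(u, v) \<in> dir_edges T"
  shows "signed_count levels (n \<bullet> u) (n \<bullet> v) = bar_crossing T n u v"
proof -
  note card = card_bar_points_on_edge[OF assms, unfolded levels_on_edge[OF assms, symmetric]]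
  have uv: "n \<bullet> u \<notin> levels" "n \<bullet> v \<notin> levels"
    using dir_edge_verts[OF assms] vertex_not_level by blast+
  have open_closed: "levels \<inter> {min (n \<bullet> u) (n \<bullet> v)<..<max (n \<bullet> u) (n \<bullet> v)} = levels \<inter> closed_segment (n \<bullet> u) (n \<bullet> v)"
    using uv by (auto simp: closed_segment_eq_real_ivl order_less_le min_def max_def)
  have dir: "dir_sign n u v = (if n \<bullet> u < n \<bullet> v then 1 else if n \<bullet> v < n \<bullet> u then - 1 else 0)"
    by (simp add: dir_sign_def inner_diff_right)
  consider "n \<bullet> u < n \<bullet> v" | "n \<bullet> v < n \<bullet> u" | "n \<bullet> u = n \<bullet> v" by linarith
  then show ?thesis
    unfolding bar_crossing_eq[OF assms] dir signed_count_def
    using card open_closed by cases (auto simp: min_def max_def)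
qed

lemma bars_crossed_eq:
  assumes "(u, v) \<in> dir_edges T"
  shows "bars_crossed T n u v = bar_crossing T n u v"
proof -
  have "{b \<in> bars T n. b \<inter> closed_segment u v \<noteq> {}} = level_set ` (\<lambda>x. n \<bullet> x) ` (bar_points \<inter> closed_segment u v)"
  proof
    show "{b \<in> bars T n. b \<inter> closed_segment u v \<noteq> {}} \<subseteq> level_set ` (\<lambda>x. n \<bullet> x) ` (bar_points \<inter> closed_segment u v)"
    proof
      fix b assume "b \<in> {b \<in> bars T n. b \<inter> closed_segment u v \<noteq> {}}"
      then obtain c x where "c \<in> levels" "b = level_set c" "x \<in> b" "x \<in> closed_segment u v"
        unfolding bars_eq by blast
      then show "b \<in> level_set ` (\<lambda>x. n \<bullet> x) ` (bar_points \<inter> closed_segment u v)"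
        using bar_points_iff[of x] by (auto simp: level_set_def)
    qed
    show "level_set ` (\<lambda>x. n \<bullet> x) ` (bar_points \<inter> closed_segment u v) \<subseteq> {b \<in> bars T n. b \<inter> closed_segment u v \<noteq> {}}"
      unfolding bars_eq using bar_points_iff by (auto simp: level_set_def)
  qed
  then have "card {b \<in> bars T n. b \<inter> closed_segment u v \<noteq> {}}
      = (if bar_points \<inter> closed_segment u v = {} then 0 else 1)"
    using card_image[OF inj_on_subset[OF inj_level_set subset_UNIV]] card_bar_points_on_edge[OF assms] by metis
  then show ?thesis
    unfolding bars_crossed_def bar_crossing_eq[OF assms] by simp
qed

lemma ammann_height_is_potential:
  assumes "v0 \<in> verts T"
  shows "is_potential T n (ammann_height T n v0)"
  unfolding is_potential_def
proof (intro ballI, clarify)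
  fix u v assume uv: "(u, v) \<in> dir_edges T"
  have "signed_count levels (n \<bullet> v0) (n \<bullet> v)
      = signed_count levels (n \<bullet> v0) (n \<bullet> u) + signed_count levels (n \<bullet> u) (n \<bullet> v)"
    using signed_count_add[OF finite_levels] vertex_not_level assms dir_edge_verts[OF uv] by blast
  then show "bar_crossing T n u v = ammann_height T n v0 v - ammann_height T n v0 u"
    unfolding ammann_height_eq using signed_count_edge[OF uv] by simp
qed

section \<open>Connectedness of the tiling graph\<close>

text \<open>
  This is the connectedness of the tiling graph, in the form in which it is applied. Such an \<open>f\<close>
  takes a single value on the corners of each tile, and tiles that touch have a common corner. So the
  tiles with the value of a given tile and the remaining tiles cover the plane by two disjoint
  closed sets.
\<close>
lemma edge_invariant_constant:
  assumes inv: "\<And>u v. (u, v) \<in> dir_edges T \<Longrightarrow> f u = f v"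
    and "v \<in> verts T" "w \<in> verts T"
  shows "f v = f w"
proof -
  have tile: "f x = f (cA t)" if "t \<in> T" "x \<in> corners t" for t x
  proof -
    have "{cA t, cB t} \<in> edges t" "{cA t, cD t} \<in> edges t" "{cC t, cB t} \<in> edges t"
      by (auto simp: edges_eq)
    then have "f (cA t) = f (cB t)" "f (cA t) = f (cD t)" "f (cC t) = f (cB t)"
      using inv that(1) unfolding dir_edges_def by blast+
    then show ?thesis using that(2) by (auto simp: corners_def)
  qed
  have touch: "f (cA s) = f (cA t)" if st: "s \<in> T" "t \<in> T" and x: "x \<in> region s" "x \<in> region t" for s t x
  proof (cases "s = t")
    case False
    have "x \<notin> interior (region s)"
      using interior_disjoint_region[OF P2 st False] x(2) by blast
    then obtain e where e: "e \<in> edges s" "x \<in> convex hull e"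
      using boundary_imp_edge[OF valid[OF st(1)] x(1)] by blast
    obtain e' where e': "e' \<in> edges t" "e' = e \<or> x \<in> corners s \<inter> corners t"
      using shared_edge[OF st e x(2)] by blast
    have "\<exists>y. y \<in> corners s \<inter> corners t"
    proof (cases "e' = e")
      case True
      moreover obtain y where "y \<in> e" using e(2) by fastforce
      ultimately show ?thesis
        using edge_subset_corners[OF e(1)] edge_subset_corners[OF e'(1)] by blast
    qed (use e' in blast)
    then show ?thesis using tile st by (metis IntE)
  qed simp
  obtain s t where s: "s \<in> T" "v \<in> corners s" and t: "t \<in> T" "w \<in> corners t"
    using assms(2,3) by (auto simp: verts_def)
  define A where "A = {r \<in> T. f (cA r) = f (cA s)}"
  let ?U = "\<Union>r\<in>A. region r" and ?V = "\<Union>r\<in>T - A. region r"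
  have "closed ?U" "closed ?V"
    by (rule closed_UN_tiles[OF P2]; use closed_region in \<open>auto simp: A_def\<close>)+
  moreover have "?U \<inter> ?V = {}"
  proof (rule ccontr)
    assume "?U \<inter> ?V \<noteq> {}"
    then obtain x a b where "a \<in> A" "b \<in> T - A" "x \<in> region a" "x \<in> region b" by blast
    then show False using touch[of a b x] by (auto simp: A_def)
  qed
  moreover have "?U \<union> ?V = UNIV"
    using cover by blast
  moreover have "cA s \<in> ?U"
    using s(1) by (auto simp: A_def region_def hull_inc)
  ultimately have "?V = {}"
    using connected_closedD[OF connected_UNIV, of ?U ?V] by blast
  moreover have "cA t \<in> region t" by (auto simp: region_def hull_inc)
  ultimately have "t \<in> A" using t(1) by blast
  then have "f (cA t) = f (cA s)" by (simp add: A_def)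
  then show ?thesis using tile s t by metis
qed

lemma potential_unique:
  assumes "is_potential T n h" "is_potential T n h'" "v \<in> verts T" "w \<in> verts T"
  shows "h' v - h v = h' w - h w"
proof (rule edge_invariant_constant[OF _ assms(3,4)])
  fix u v assume "(u, v) \<in> dir_edges T"
  then have "h v - h u = h' v - h' u"
    using assms(1,2) unfolding is_potential_def by fastforce
  then show "h' u - h u = h' v - h v" by simp
qed

lemma verts_nonempty: "\<exists>v. v \<in> verts T"
proof -
  obtain t where "t \<in> T" using cover by blast
  then show ?thesis by (auto simp: verts_def corners_def)
qed

lemma sum_along_walk:
  assumes "is_potential T n h" "walk T w m"
  shows "(\<Sum>i<m. bar_crossing T n (w i) (w (Suc i))) = h (w m) - h (w 0)"
proof -
  have "bar_crossing T n (w i) (w (Suc i)) = h (w (Suc i)) - h (w i)" if "i < m" for i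
    using assms that unfolding is_potential_def walk_def by fastforce
  then show ?thesis using sum_lessThan_telescope[of "\<lambda>i. h (w i)" m] by simp
qed

end

theorem proposition4p10:
  fixes T :: "tile set" and n :: complex and k :: nat
  assumes "P2_tiling T" and "matching_rules T"
    and "k < 5" and "n = ammann_normal k"
  shows "(\<forall>w m. walk T w m \<and> w m = w 0 \<longrightarrow>
            (\<Sum>i<m. bar_crossing T n (w i) (w (Suc i))) = 0)
       \<and> ((\<exists>h. is_potential T n h) \<and>
          (\<forall>h h'. is_potential T n h \<and> is_potential T n h' \<longrightarrow>
             (\<exists>c. \<forall>v\<in>verts T. h' v = h v + c)))
       \<and> (\<forall>h. \<forall>v0\<in>verts T. is_potential T n h \<and> h v0 = 0 \<longrightarrow>
            (\<forall>v\<in>verts T.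
               h v = ammann_height T n v0 v \<and>
               (\<forall>w m. walk T w m \<and> w 0 = v0 \<and> w m = v \<longrightarrow>
                  h v = (\<Sum>i<m. bars_crossed T n (w i) (w (Suc i))))))"
proof -
  interpret penrose_tiling T n
    using assms by unfold_locales (auto simp: ammann_normal_def)
  obtain v1 where v1: "v1 \<in> verts T" using verts_nonempty by blast
  note H = ammann_height_is_potential
  have closure: "(\<Sum>i<m. bar_crossing T n (w i) (w (Suc i))) = 0" if "walk T w m" "w m = w 0" for w m
    using sum_along_walk[OF H[OF v1] that(1)] that(2) by simp
  have unique: "\<exists>c. \<forall>v\<in>verts T. h' v = h v + c" if "is_potential T n h" "is_potential T n h'" for h h'
  proof (intro exI ballI)
    fix v assume "v \<in> verts T"
    from potential_unique[OF that this v1] show "h' v = h v + (h' v1 - h v1)"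
      by simp
  qed
  have height: "h v = ammann_height T n v0 v"
    if "is_potential T n h" "h v0 = 0" "v0 \<in> verts T" "v \<in> verts T" for h v0 v
  proof -
    have "ammann_height T n v0 v0 = 0" by (simp add: ammann_height_def)
    then show ?thesis
      using potential_unique[OF that(1) H[OF that(3)] that(4,3)] that(2) by simp
  qed
  have crossed: "h v = (\<Sum>i<m. bars_crossed T n (w i) (w (Suc i)))"
    if "is_potential T n h" "h v0 = 0" "walk T w m" "w 0 = v0" "w m = v" for h v0 v w m
  proof -
    have "(\<Sum>i<m. bars_crossed T n (w i) (w (Suc i))) = (\<Sum>i<m. bar_crossing T n (w i) (w (Suc i)))"
      using that(3) bars_crossed_eq unfolding walk_def by (intro sum.cong) auto
    then show ?thesis using sum_along_walk[OF that(1,3)] that by simp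
  qed
  show ?thesis
    using closure H[OF v1] unique height crossed by blast
qed

end
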